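(* Let $n\ge 4$ and let $G$ be a tricyclic graph on $n$ vertices. Then $ER(G)\le ER(Z_n^1)$, with equality if and only if $G\cong Z_n^1$.
   Context: All graphs are finite, simple and undirected. For a graph $G$ on $n$ vertices with adjacency eigenvalues $\lambda_1\ge\cdots\ge\lambda_n$, the resolvent energy is $ER(G)=\sum_{i=1}^n \frac{1}{n-\lambda_i}$. A tricyclic graph is a connected graph with $n$ vertices and $n+2$ edges. $Z_n^1$ denotes the tricyclic graph obtained from the complete graph $K_4$ by attaching $n-4$ pendent vertices to one of its vertices (its characteristic polynomial is $\lambda^{n-5}\big(\lambda^5-(n+2)\lambda^3-8\lambda^2+3(n-5)\lambda+2(n-4)\big)$). *)

theory Defs
  imports
    "HOL-Computational_Algebra.Polynomial"
    "Graph_Theory.Graph_Theory"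
    "Jordan_Normal_Form.Char_Poly"
begin

text \<open>
  A finite simple undirected graph is a \<open>pair_graph\<close>: a finite loop-free digraph without
  parallel arcs whose arc relation is symmetric. Each undirected edge thus contributes two arcs,
  so edges are counted as unordered pairs.
\<close>

definition undirected_edges :: "'a pair_pre_digraph \<Rightarrow> 'a set set" where
  "undirected_edges G = (\<lambda>(u, v). {u, v}) ` parcs G"

definition tricyclic :: "'a pair_pre_digraph \<Rightarrow> bool" where
  "tricyclic G \<longleftrightarrow>
     pair_graph G \<and>
     Digraph_Component.connected (with_proj G) \<and>
     card (undirected_edges G) = card (pverts G) + 2"

definition adjacency_matrix :: "'a list \<Rightarrow> 'a pair_pre_digraph \<Rightarrow> real mat" where
  "adjacency_matrix vs G =
     mat (length vs) (length vs) (\<lambda>(i, j). if (vs ! i, vs ! j) \<in> parcs G then 1 else 0)"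

text \<open>
  Another enumeration of the vertices conjugates the adjacency matrix by a permutation matrix, so
  the spectrum does not depend on the choice made here. The matrix is real symmetric, hence its
  characteristic polynomial splits over the reals and the multiset below contains all
  \<open>card (pverts G)\<close> eigenvalues, with multiplicity.
\<close>

definition adjacency_eigenvalues :: "'a pair_pre_digraph \<Rightarrow> real multiset" where
  "adjacency_eigenvalues G =
     proots (char_poly (adjacency_matrix (SOME vs. distinct vs \<and> set vs = pverts G) G))"

definition resolvent_energy :: "'a pair_pre_digraph \<Rightarrow> real" where
  "resolvent_energy G =
     (\<Sum>x\<in>#adjacency_eigenvalues G. 1 / (real (card (pverts G)) - x))"

text \<open>
  The complete graph on \<open>{0, 1, 2, 3}\<close> with the pendent vertices \<open>4, \<dots>, n - 1\<close> attached to
  vertex \<open>0\<close>; meaningful for \<open>n \<ge> 4\<close> only.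
\<close>

definition Z1_graph :: "nat \<Rightarrow> nat pair_pre_digraph" where
  "Z1_graph n =
     \<lparr> pverts = {0..<n},
       parcs = {(u, v). u < 4 \<and> v < 4 \<and> u \<noteq> v} \<union> {0} \<times> {4..<n} \<union> {4..<n} \<times> {0} \<rparr>"

end

theory Submission
  imports Defs "Jordan_Normal_Form.Schur_Decomposition"
begin

text \<open>
  For a graph with \<open>n\<close> vertices, \<open>ER(G)\<close> is the trace of \<open>(nI - A)\<^sup>-\<^sup>1\<close>. The Kelmans move from \<open>v\<close>
  to \<open>u\<close> replaces the edges \<open>vw\<close>, for \<open>w\<close> a neighbour of \<open>v\<close> but not of \<open>u\<close>, by \<open>uw\<close>. In the basis
  \<open>e\<^sub>u + e\<^sub>v\<close>, \<open>e\<^sub>u - e\<^sub>v\<close>, \<open>e\<^sub>w\<close> it only replaces the coupling vector \<open>c\<close> of \<open>e\<^sub>u - e\<^sub>v\<close> by \<open>\<bar>c\<bar>\<close>, and by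
  the Schur complement formula this increases the trace, strictly unless the neighbourhoods of \<open>u\<close>
  and \<open>v\<close> are nested. The move preserves tricyclicity if \<open>u\<close> and \<open>v\<close> are adjacent or have a common
  neighbour. Hence in a maximizer adjacent vertices have nested neighbourhoods, which makes a vertex
  of maximal degree dominating; then all neighbourhoods are nested, so the three edges avoiding that
  vertex pairwise intersect and form a triangle, giving \<open>Z\<^sub>n\<^sup>1\<close>, or a star. In the latter case the
  trace is computed explicitly and is smaller than that of \<open>Z\<^sub>n\<^sup>1\<close>.
\<close>

section \<open>Left inverses and Schur complements\<close>

text \<open>Matrices are functions on an index set, so that vertices serve as indices without an
  enumeration and a single index can be adjoined with \<open>insert\<close>.\<close>

definition left_inverse_on :: "'a set \<Rightarrow> ('a \<Rightarrow> 'a \<Rightarrow> real) \<Rightarrow> ('a \<Rightarrow> 'a \<Rightarrow> real) \<Rightarrow> bool" where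
  "left_inverse_on V T N \<longleftrightarrow>
     (\<forall>i\<in>V. \<forall>j\<in>V. (\<Sum>k\<in>V. T i k * N k j) = (if i = j then 1 else 0))"

lemma left_inverse_onD:
  "left_inverse_on V T N \<Longrightarrow> i \<in> V \<Longrightarrow> j \<in> V \<Longrightarrow>
     (\<Sum>k\<in>V. T i k * N k j) = (if i = j then 1 else 0)"
  by (simp add: left_inverse_on_def)

lemma left_inverse_on_cong:
  assumes "\<And>i j. i \<in> V \<Longrightarrow> j \<in> V \<Longrightarrow> N i j = N' i j"
  shows "left_inverse_on V T N \<longleftrightarrow> left_inverse_on V T N'"
  using assms by (simp add: left_inverse_on_def cong: sum.cong)

text \<open>Block inversion: \<open>d\<close> is the Schur complement of the block on
  \<open>V\<close>, and \<open>T'\<close> is the bordered inverse built from \<open>p\<close>, the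
  image under \<open>T\<close> of column \<open>v\<close>, and \<open>q\<close>, row
  \<open>v\<close> multiplied by \<open>T\<close>. The trace formula isolates the influence of the
  row and column of \<open>v\<close> in a single fraction; the energy comparisons rest on
  it.\<close>

lemma schur_complement_left_inverse:
  fixes N T :: "'a \<Rightarrow> 'a \<Rightarrow> real"
  assumes fin: "finite V" and v: "v \<notin> V" and T: "left_inverse_on V T N"
    and p: "\<And>i. i \<in> V \<Longrightarrow> p i = (\<Sum>k\<in>V. T i k * N k v)"
    and q: "\<And>j. j \<in> V \<Longrightarrow> q j = (\<Sum>k\<in>V. N v k * T k j)"
    and d: "d = N v v - (\<Sum>k\<in>V. N v k * p k)" "d \<noteq> 0"
    and T': "T' = (\<lambda>i j. if i = v then (if j = v then 1 / d else - q j / d)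
                  else if j = v then - p i / d else T i j + p i * q j / d)"
  shows "left_inverse_on (insert v V) T' N"
    and "(\<Sum>i\<in>insert v V. T' i i) = (\<Sum>i\<in>V. T i i) + (1 + (\<Sum>i\<in>V. p i * q i)) / d"
proof -
  have id: "(\<Sum>k\<in>V. T i k * N k j) = (if i = j then 1 else 0)" if "i \<in> V" "j \<in> V" for i j
    using T that by (auto simp: left_inverse_on_def)
  \<comment> \<open>By associativity \<open>q N = N\<^sub>v (T N) = N\<^sub>v\<close> on
    \<open>V\<close>, so a left inverse on \<open>V\<close> suffices.\<close>
  have qN: "(\<Sum>k\<in>V. q k * N k j) = N v j" if "j \<in> V" for j
  proof -
    have "(\<Sum>k\<in>V. q k * N k j) = (\<Sum>k\<in>V. \<Sum>l\<in>V. N v l * (T l k * N k j))"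
      by (simp add: q sum_distrib_right mult.assoc)
    also have "\<dots> = (\<Sum>l\<in>V. N v l * (\<Sum>k\<in>V. T l k * N k j))"
      by (subst sum.swap) (simp add: sum_distrib_left)
    also have "\<dots> = (\<Sum>l\<in>V. if l = j then N v l else 0)"
      using that by (intro sum.cong) (auto simp: id)
    finally show ?thesis using fin that by simp
  qed
  have qv: "(\<Sum>k\<in>V. q k * N k v) = (\<Sum>k\<in>V. N v k * p k)"
  proof -
    have "(\<Sum>k\<in>V. q k * N k v) = (\<Sum>k\<in>V. \<Sum>l\<in>V. N v l * (T l k * N k v))"
      by (simp add: q sum_distrib_right mult.assoc)
    also have "\<dots> = (\<Sum>l\<in>V. N v l * (\<Sum>k\<in>V. T l k * N k v))"
      by (subst sum.swap) (simp add: sum_distrib_left)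
    finally show ?thesis by (simp add: p)
  qed
  have ne: "k \<noteq> v" if "k \<in> V" for k using v that by auto
  show "left_inverse_on (insert v V) T' N"
    unfolding left_inverse_on_def
  proof (intro ballI)
    fix i j assume ij: "i \<in> insert v V" "j \<in> insert v V"
    have *: "(\<Sum>k\<in>insert v V. T' i k * N k j) = T' i v * N v j + (\<Sum>k\<in>V. T' i k * N k j)"
      using fin v by simp
    show "(\<Sum>k\<in>insert v V. T' i k * N k j) = (if i = j then 1 else 0)"
    proof (cases "i = v")
      case True
      have "(\<Sum>k\<in>V. T' i k * N k j) = - (\<Sum>k\<in>V. q k * N k j) / d"
        by (simp add: True T' ne sum_divide_distrib sum_negf cong: sum.cong)
      moreover have "(\<Sum>k\<in>V. q k * N k j) = (if j = v then N v v - d else N v j)"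
        using ij qv qN d by auto
      ultimately show ?thesis using * d(2) True by (auto simp: T' field_simps)
    next
      case False
      then have iV: "i \<in> V" using ij by auto
      have "(\<Sum>k\<in>V. T' i k * N k j) = (\<Sum>k\<in>V. T i k * N k j + p i / d * (q k * N k j))"
        using False by (intro sum.cong) (auto simp: T' ne algebra_simps)
      also have "\<dots> = (\<Sum>k\<in>V. T i k * N k j) + p i / d * (\<Sum>k\<in>V. q k * N k j)"
        by (simp add: sum.distrib sum_distrib_left)
      also have "(\<Sum>k\<in>V. q k * N k j) = (if j = v then N v v - d else N v j)"
        using ij qv qN d by auto
      also have "(\<Sum>k\<in>V. T i k * N k j) = (if j = v then p i else if i = j then 1 else 0)"
        using ij iV id p by auto
      finally have S: "(\<Sum>k\<in>V. T' i k * N k j) =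
        (if j = v then p i else if i = j then 1 else 0)
          + p i / d * (if j = v then N v v - d else N v j)" .
      have Tv: "T' i v = - p i / d" using False by (simp add: T')
      show ?thesis unfolding * S Tv using d(2) False by (auto simp: field_simps)
    qed
  qed
  have "(\<Sum>i\<in>V. T' i i) = (\<Sum>i\<in>V. T i i) + (\<Sum>i\<in>V. p i * q i) / d"
    by (simp add: T' ne sum.distrib sum_divide_distrib cong: sum.cong)
  then show "(\<Sum>i\<in>insert v V. T' i i) = (\<Sum>i\<in>V. T i i) + (1 + (\<Sum>i\<in>V. p i * q i)) / d"
    using fin v by (simp add: T' add_divide_distrib)
qed

text \<open>A strictly diagonally dominant matrix with nonpositive off-diagonal entries is an
  M-matrix. Indices are adjoined one at a time: with \<open>p\<close> and \<open>q\<close>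
  nonpositive and \<open>d\<close> positive, every entry of the bordered inverse is
  nonnegative.\<close>

lemma M_matrix_left_inverse:
  fixes C :: "'a \<Rightarrow> 'a \<Rightarrow> real"
  assumes "finite V"
    and "\<And>i j. i \<in> V \<Longrightarrow> j \<in> V \<Longrightarrow> 0 \<le> C i j"
    and "\<And>i. i \<in> V \<Longrightarrow> (\<Sum>j\<in>V. C i j) < x"
  shows "\<exists>T. left_inverse_on V T (\<lambda>i j. (if i = j then x else 0) - C i j) \<and>
             (\<forall>i\<in>V. \<forall>j\<in>V. 0 \<le> T i j)"
  using assms
proof (induction V rule: finite_induct)
  case empty
  then show ?case by (simp add: left_inverse_on_def)
next
  case (insert v V)
  define N where "N = (\<lambda>i j. (if i = j then x else 0) - C i j)"
  have C: "0 \<le> C i j" if "i \<in> insert v V" "j \<in> insert v V" for i j using insert.prems(1) that .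
  have row: "C i v + (\<Sum>j\<in>V. C i j) < x" if "i \<in> insert v V" for i
    using insert.prems(2)[OF that] insert.hyps by simp
  have "(\<Sum>j\<in>V. C i j) < x" if "i \<in> V" for i
    using row[of i] C[of i v] that by auto
  then obtain T where T: "left_inverse_on V T N" and pos: "\<And>i j. i \<in> V \<Longrightarrow> j \<in> V \<Longrightarrow> 0 \<le> T i j"
    using insert.IH C unfolding N_def by auto
  define p where "p i = (\<Sum>k\<in>V. T i k * N k v)" for i
  define q where "q j = (\<Sum>k\<in>V. N v k * T k j)" for j
  define d where "d = N v v - (\<Sum>k\<in>V. N v k * p k)"
  have ne: "k \<noteq> v" if "k \<in> V" for k using insert.hyps that by auto
  \<comment> \<open>Apply \<open>T N = I\<close> to the all-one vector. By dominance the row sum of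
    \<open>N\<close> over \<open>V\<close> is at least \<open>- N k v\<close>, and \<open>T\<close>
    is nonnegative, so \<open>1\<close> is at least \<open>- p i\<close>.\<close>
  have p_le: "- p i \<le> 1" if i: "i \<in> V" for i
  proof -
    have "1 = (\<Sum>j\<in>V. if i = j then 1 else 0::real)" using i insert.hyps by simp
    also have "\<dots> = (\<Sum>j\<in>V. \<Sum>k\<in>V. T i k * N k j)"
      using T i by (simp add: left_inverse_on_def)
    also have "\<dots> = (\<Sum>k\<in>V. T i k * (\<Sum>j\<in>V. N k j))"
      by (subst sum.swap) (simp add: sum_distrib_left)
    also have "\<dots> \<ge> (\<Sum>k\<in>V. T i k * (- N k v))"
    proof (intro sum_mono mult_left_mono pos i)
      fix k assume k: "k \<in> V"
      have "(\<Sum>j\<in>V. N k j) = x - (\<Sum>j\<in>V. C k j)"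
        using k insert.hyps by (simp add: N_def sum_subtractf)
      then show "- N k v \<le> (\<Sum>j\<in>V. N k j)" using row[of k] k ne by (auto simp: N_def)
    qed
    finally show ?thesis by (simp add: p_def sum_negf)
  qed
  have Nv: "N v k \<le> 0" "N k v \<le> 0" if "k \<in> V" for k
    using C[of v k] C[of k v] ne[OF that] that by (auto simp: N_def)
  have p_nonpos: "p i \<le> 0" if "i \<in> V" for i
    unfolding p_def using that by (intro sum_nonpos mult_nonneg_nonpos pos Nv)
  have q_nonpos: "q i \<le> 0" if "i \<in> V" for i
    unfolding q_def using that by (intro sum_nonpos mult_nonpos_nonneg pos Nv)
  \<comment> \<open>Since \<open>- p k\<close> is at most 1, the Schur complement is at least
    \<open>x\<close> minus the full row sum of \<open>v\<close>, hence positive.\<close>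
  have "(\<Sum>k\<in>V. N v k * p k) \<le> (\<Sum>k\<in>V. C v k)"
  proof (rule sum_mono)
    fix k assume k: "k \<in> V"
    have "C v k * (- p k) \<le> C v k * 1" using p_le[OF k] C[of v k] k by (intro mult_left_mono) auto
    then show "N v k * p k \<le> C v k" using ne[OF k] by (auto simp: N_def)
  qed
  then have d: "d > 0" using row[of v] by (simp add: d_def N_def)
  define T' where "T' = (\<lambda>i j. if i = v then (if j = v then 1 / d else - q j / d)
                  else if j = v then - p i / d else T i j + p i * q j / d)"
  have "left_inverse_on (insert v V) T' N"
    using schur_complement_left_inverse(1)[OF insert.hyps T p_def q_def d_def _ T'_def] d by simp
  moreover have "0 \<le> T' i j" if "i \<in> insert v V" "j \<in> insert v V" for i j
    using that d p_nonpos q_nonpos pos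
    by (auto simp: T'_def divide_nonpos_pos intro!: add_nonneg_nonneg divide_nonneg_pos mult_nonpos_nonpos)
  ultimately show ?case unfolding N_def by blast
qed

section \<open>Resolvent energy as a trace\<close>

text \<open>The inverse of an upper triangular matrix is upper triangular, so a diagonal entry of
  the product has only one nonzero summand.\<close>

lemma upper_triangular_left_inverse_diag:
  fixes T :: "'a :: field mat"
  assumes T: "T \<in> carrier_mat n n" and S: "S \<in> carrier_mat n n"
    and ut: "upper_triangular T" and inv: "S * T = 1\<^sub>m n" and i: "i < n"
  shows "S $$ (i, i) * T $$ (i, i) = 1"
proof -
  have e: "(\<Sum>k<n. S $$ (i, k) * T $$ (k, j)) = (if i = j then 1 else 0)" if "i < n" "j < n" for i j
  proof -
    have "(S * T) $$ (i, j) = (\<Sum>k<n. S $$ (i, k) * T $$ (k, j))"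
      using S T that by (simp add: scalar_prod_def atLeast0LessThan)
    then show ?thesis using inv that by simp
  qed
  have z: "T $$ (k, j) = 0" if "j < k" "k < n" for k j
    using ut T that by auto
  \<comment> \<open>Terms with \<open>k > j\<close> vanish because \<open>T\<close> is triangular,
    those with \<open>k < j\<close> by the assumption on row \<open>i\<close>. Applied along a row
    from left to right, this clears \<open>S\<close> below the diagonal.\<close>
  have tri: "(\<Sum>k<n. S $$ (i, k) * T $$ (k, j)) = S $$ (i, j) * T $$ (j, j)"
    if "j < n" "\<And>k. k < j \<Longrightarrow> S $$ (i, k) = 0" for i j
  proof -
    have "S $$ (i, k) * T $$ (k, j) = 0" if "k \<in> {..<n} - {j}" for k
      using \<open>\<And>k. k < j \<Longrightarrow> S $$ (i, k) = 0\<close>[of k] z[of j k] that by (cases k j rule: linorder_cases) auto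
    then have "(\<Sum>k\<in>{..<n} - {j}. S $$ (i, k) * T $$ (k, j)) = 0" by (rule sum.neutral[OF ballI])
    then show ?thesis using that(1) by (subst sum.remove[of _ j]) auto
  qed
  have "det S * det T = 1" using det_mult[OF S T] inv by simp
  then have "det T \<noteq> 0" by auto
  then have "prod_list (diag_mat T) \<noteq> 0" using det_upper_triangular[OF ut T] by simp
  then have nz: "T $$ (j, j) \<noteq> 0" if "j < n" for j
    using that T by (auto simp: diag_mat_def prod_list_zero_iff)
  have low: "S $$ (i, j) = 0" if "i < n" "j < i" for i j
    using that(2)
  proof (induction j rule: less_induct)
    case (less j)
    have jn: "j < n" using less.prems that by simp
    have "S $$ (i, j) * T $$ (j, j) = 0"
      using tri[OF jn, of i] less e[OF that(1) jn] by auto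
    then show ?case using nz[OF jn] by simp
  qed
  show ?thesis using tri[OF i, of i] low[OF i] e[OF i i] by auto
qed

text \<open>Factor over the complex numbers and show that every root is real. The real factorization
  is what makes the Schur decomposition applicable to the real matrix.\<close>

lemma symmetric_real_char_poly_splits:
  fixes A :: "real mat"
  assumes A: "A \<in> carrier_mat n n"
    and sym: "\<And>i j. i < n \<Longrightarrow> j < n \<Longrightarrow> A $$ (i, j) = A $$ (j, i)"
  shows "\<exists>es. char_poly A = (\<Prod>e\<leftarrow>es. [:- e, 1:])"
proof -
  let ?A = "map_mat complex_of_real A"
  interpret h: map_poly_comm_ring_hom complex_of_real ..
  have A': "?A \<in> carrier_mat n n" using A by simp
  obtain as where as: "char_poly ?A = (\<Prod>a\<leftarrow>as. [:- a, 1:])"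
    using char_poly_factorized[OF A'] by blast
  have real: "of_real (Re a) = a" if "a \<in> set as" for a
  proof -
    have "poly (char_poly ?A) a = 0"
      using that unfolding as by (induction as) auto
    then obtain v where "eigenvector ?A v a"
      using eigenvalue_root_char_poly[OF A'] by (auto simp: eigenvalue_def)
    then have v: "v \<in> carrier_vec n" "v \<noteq> 0\<^sub>v n" "?A *\<^sub>v v = a \<cdot>\<^sub>v v"
      using A by (auto simp: eigenvector_def)
    have row: "(\<Sum>j<n. of_real (A $$ (i, j)) * v $ j) = a * v $ i" if "i < n" for i
    proof -
      have "(?A *\<^sub>v v) $ i = (\<Sum>j<n. of_real (A $$ (i, j)) * v $ j)"
        using v(1) A that by (simp add: scalar_prod_def atLeast0LessThan)
      then show ?thesis using v that by simp
    qed
    \<comment> \<open>\<open>S\<close> is the Hermitian form of \<open>A\<close> at the eigenvector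
      \<open>v\<close>. It equals \<open>a\<close> times the squared norm \<open>m\<close> and, by
      symmetry of \<open>A\<close>, its own conjugate; as \<open>m > 0\<close>, \<open>a\<close> is
      real.\<close>
    define S where "S = (\<Sum>i<n. \<Sum>j<n. cnj (v $ i) * (of_real (A $$ (i, j)) * v $ j))"
    define m where "m = (\<Sum>i<n. (cmod (v $ i))\<^sup>2)"
    have "S = (\<Sum>i<n. cnj (v $ i) * (\<Sum>j<n. of_real (A $$ (i, j)) * v $ j))"
      by (simp add: S_def sum_distrib_left)
    also have "\<dots> = (\<Sum>i<n. a * of_real ((cmod (v $ i))\<^sup>2))"
      by (intro sum.cong refl) (simp add: row complex_norm_square del: of_real_power)
    also have "\<dots> = a * of_real m"
      by (simp add: m_def sum_distrib_left)
    finally have S1: "S = a * of_real m" .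
    have "cnj S = (\<Sum>i<n. \<Sum>j<n. cnj (v $ j) * (of_real (A $$ (j, i)) * v $ i))"
      unfolding S_def cnj_sum by (intro sum.cong refl) (auto simp: sym mult_ac)
    also have "\<dots> = S" unfolding S_def by (subst sum.swap) simp
    finally have S2: "cnj S = S" .
    obtain i where i: "i < n" "v $ i \<noteq> 0" using v by (auto simp: vec_eq_iff)
    have "0 < (cmod (v $ i))\<^sup>2" using i by simp
    also have "\<dots> \<le> m" unfolding m_def using i by (intro member_le_sum) auto
    finally have "m > 0" .
    then have "cnj a = a" using S1 S2 by simp
    then show ?thesis by (simp add: complex_eq_iff)
  qed
  have "map_poly of_real (char_poly A) = char_poly ?A"
    using of_real_hom.char_poly_hom[OF A] by metis
  also have "\<dots> = (\<Prod>a\<leftarrow>as. [:- of_real (Re a), 1:])"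
    unfolding as using real by (intro arg_cong[where f = prod_list] map_cong) auto
  also have "\<dots> = map_poly of_real (\<Prod>a\<leftarrow>map Re as. [:- a, 1:])"
    by (induction as) (simp_all add: h.hom_mult del: mult_pCons_left)
  finally have "char_poly A = (\<Prod>a\<leftarrow>map Re as. [:- a, 1:])"
    by (metis (no_types, lifting) coeff_map_poly of_real_0 of_real_eq_iff poly_eqI)
  then show ?thesis by blast
qed

lemma sum_diag_mult_comm:
  fixes A B :: "'a :: comm_ring_1 mat"
  assumes "A \<in> carrier_mat n n" "B \<in> carrier_mat n n"
  shows "(\<Sum>i<n. (A * B) $$ (i, i)) = (\<Sum>i<n. (B * A) $$ (i, i))"
proof -
  have "(\<Sum>i<n. (A * B) $$ (i, i)) = (\<Sum>i<n. \<Sum>k<n. A $$ (i, k) * B $$ (k, i))"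
    using assms by (simp add: scalar_prod_def atLeast0LessThan)
  also have "\<dots> = (\<Sum>k<n. \<Sum>i<n. B $$ (k, i) * A $$ (i, k))"
    by (subst sum.swap) (simp add: mult.commute)
  also have "\<dots> = (\<Sum>i<n. (B * A) $$ (i, i))"
    using assms by (simp add: scalar_prod_def atLeast0LessThan)
  finally show ?thesis .
qed

text \<open>Schur triangularization turns \<open>A\<close> into a triangular \<open>B\<close> with
  the eigenvalues on its diagonal. The same conjugation turns \<open>R\<close> into a left inverse
  of \<open>xI - B\<close>, whose diagonal consists of the reciprocals \<open>1 / (x - e)\<close>;
  the trace does not change.\<close>

lemma sum_resolvent_roots_eq_diag_sum:
  fixes A R :: "real mat"
  assumes A: "A \<in> carrier_mat n n" and R: "R \<in> carrier_mat n n"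
    and es: "char_poly A = (\<Prod>e\<leftarrow>es. [:- e, 1:])"
    and inv: "R * (x \<cdot>\<^sub>m 1\<^sub>m n - A) = 1\<^sub>m n"
  shows "(\<Sum>e\<in>#proots (char_poly A). 1 / (x - e)) = (\<Sum>i<n. R $$ (i, i))"
proof -
  obtain B P Q where "schur_decomposition A es = (B, P, Q)" by (cases "schur_decomposition A es")
  from schur_decomposition[OF A es this]
  have sim: "similar_mat_wit A B P Q" and B: "upper_triangular B" "diag_mat B = es" by auto
  note w = similar_mat_witD2[OF A sim]
  let ?T = "x \<cdot>\<^sub>m 1\<^sub>m n - B"
  let ?S = "Q * R * P"
  have T: "?T \<in> carrier_mat n n" and S: "?S \<in> carrier_mat n n"
    and D: "x \<cdot>\<^sub>m 1\<^sub>m n - A \<in> carrier_mat n n" using w R by auto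
  have "A * P = P * B"
  proof -
    have "A * P = (P * B) * (Q * P)" using w by (subst w(3), subst assoc_mult_mat[of _ n n Q n P n]) auto
    then show ?thesis using w by simp
  qed
  then have "P * ?T = (x \<cdot>\<^sub>m 1\<^sub>m n - A) * P"
    using w(4-7) by (simp add: mult_minus_distrib_mat[of P n n _ n] minus_mult_distrib_mat[of _ n n A P n]
        mult_smult_distrib[of P n n "1\<^sub>m n" n] mult_smult_assoc_mat[of "1\<^sub>m n" n n P n])
  then have "?S * ?T = Q * (R * (x \<cdot>\<^sub>m 1\<^sub>m n - A)) * P"
    using w(4-7) R T D by (simp add: assoc_mult_mat[of _ n n _ n _ n])
  then have "?S * ?T = 1\<^sub>m n" using inv w(2,4-7) by simp
  moreover have "upper_triangular ?T" using B w(5) by (auto simp: upper_triangular_def)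
  ultimately have d: "?S $$ (i, i) * (x - B $$ (i, i)) = 1" if "i < n" for i
    using upper_triangular_left_inverse_diag[OF T S _ _ that] that w(5) by simp
  have "proots (char_poly A) = mset es"
    unfolding es
  proof (induction es)
    case (Cons e es)
    have "(\<Prod>e\<leftarrow>es. [:- e, 1:]) \<noteq> 0" by (auto simp: prod_list_zero_iff)
    then have "proots ([:- e, 1:] * (\<Prod>e\<leftarrow>es. [:- e, 1:])) = {#e#} + mset es"
      by (subst proots_mult) (simp_all add: Cons del: mult_pCons_left)
    then show ?case by (simp del: mult_pCons_left)
  qed simp
  then have "(\<Sum>e\<in>#proots (char_poly A). 1 / (x - e)) = (\<Sum>e\<leftarrow>es. 1 / (x - e))"
    by (simp flip: sum_mset_sum_list)
  also have "\<dots> = (\<Sum>i<n. 1 / (x - B $$ (i, i)))"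
    using w(5) by (simp add: B(2)[symmetric] diag_mat_def comp_def interv_sum_list_conv_sum_set_nat atLeast0LessThan)
  also have "\<dots> = (\<Sum>i<n. ?S $$ (i, i))"
    by (intro sum.cong refl) (metis d lessThan_iff nonzero_eq_divide_eq mult_zero_right zero_neq_one)
  also have "\<dots> = (\<Sum>i<n. (P * (Q * R)) $$ (i, i))"
    using w(4-7) R by (intro sum_diag_mult_comm) auto
  also have "P * (Q * R) = R" using w(1,4-7) R by (simp flip: assoc_mult_mat[of P n n Q n R n])
  finally show ?thesis .
qed

abbreviation adj :: "'a pair_pre_digraph \<Rightarrow> 'a \<Rightarrow> 'a \<Rightarrow> real" where
  "adj G i j \<equiv> of_bool ((i, j) \<in> parcs G)"

text \<open>Removes the chosen vertex enumeration: from here on energies are traces of functions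
  indexed by vertices, and eigenvalues no longer appear.\<close>

lemma resolvent_energy_eq_diag_sum:
  fixes G :: "'a pair_pre_digraph"
  assumes fin: "finite (pverts G)" and sym: "sym (parcs G)"
    and R: "left_inverse_on (pverts G) R
              (\<lambda>i j. (if i = j then real (card (pverts G)) else 0) - adj G i j)"
  shows "resolvent_energy G = (\<Sum>i\<in>pverts G. R i i)"
proof -
  define vs where "vs = (SOME vs. distinct vs \<and> set vs = pverts G)"
  have "distinct vs \<and> set vs = pverts G"
    unfolding vs_def by (rule someI_ex) (use finite_distinct_list[OF fin] in blast)
  then have vs: "distinct vs" "set vs = pverts G" by auto
  define n where "n = length vs"
  have card: "card (pverts G) = n" using vs distinct_card n_def by metis
  have bij: "bij_betw ((!) vs) {..<n} (pverts G)"
    using vs by (auto simp: n_def intro: bij_betw_nth)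
  have mem: "vs ! i \<in> pverts G" if "i < n" for i
    using that vs(2) nth_mem[of i vs] by (simp add: n_def)
  define A where "A = adjacency_matrix vs G"
  define M where "M = mat n n (\<lambda>(i, j). R (vs ! i) (vs ! j))"
  have A: "A \<in> carrier_mat n n" and M: "M \<in> carrier_mat n n"
    by (auto simp: A_def adjacency_matrix_def n_def M_def)
  have Aij: "A $$ (i, j) = adj G (vs ! i) (vs ! j)" if "i < n" "j < n" for i j
    using that by (simp add: A_def adjacency_matrix_def n_def)
  have "A $$ (i, j) = A $$ (j, i)" if "i < n" "j < n" for i j
    using that sym by (auto simp: Aij sym_def)
  then obtain es where es: "char_poly A = (\<Prod>e\<leftarrow>es. [:- e, 1:])"
    using symmetric_real_char_poly_splits[OF A] by blast
  have "M * (real n \<cdot>\<^sub>m 1\<^sub>m n - A) = 1\<^sub>m n"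
  proof (rule eq_matI)
    fix i j assume "i < dim_row (1\<^sub>m n)" "j < dim_col (1\<^sub>m n)"
    then have ij: "i < n" "j < n" by auto
    have "(M * (real n \<cdot>\<^sub>m 1\<^sub>m n - A)) $$ (i, j) =
        (\<Sum>k<n. R (vs ! i) (vs ! k) * ((if vs ! k = vs ! j then real n else 0) - adj G (vs ! k) (vs ! j)))"
      using ij M A vs by (auto simp: scalar_prod_def atLeast0LessThan Aij M_def n_def nth_eq_iff_index_eq intro!: sum.cong)
    also have "\<dots> = (\<Sum>k\<in>pverts G. R (vs ! i) k * ((if k = vs ! j then real n else 0) - adj G k (vs ! j)))"
      by (rule sum.reindex_bij_betw[OF bij])
    also have "\<dots> = (if vs ! i = vs ! j then 1 else 0)"
      using R[unfolded left_inverse_on_def card] mem[OF ij(1)] mem[OF ij(2)] by simp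
    finally show "(M * (real n \<cdot>\<^sub>m 1\<^sub>m n - A)) $$ (i, j) = 1\<^sub>m n $$ (i, j)"
      using ij vs by (simp add: nth_eq_iff_index_eq n_def)
  qed (use M A in auto)
  from sum_resolvent_roots_eq_diag_sum[OF A M es this]
  have "resolvent_energy G = (\<Sum>i<n. M $$ (i, i))"
    by (simp add: resolvent_energy_def adjacency_eigenvalues_def A_def vs_def card)
  also have "\<dots> = (\<Sum>i<n. R (vs ! i) (vs ! i))" by (simp add: M_def)
  also have "\<dots> = (\<Sum>i\<in>pverts G. R i i)" by (rule sum.reindex_bij_betw[OF bij])
  finally show ?thesis .
qed

section \<open>The Kelmans move\<close>

text \<open>In the basis \<open>e\<^sub>u + e\<^sub>v\<close>, \<open>e\<^sub>u - e\<^sub>v\<close>, \<open>e\<^sub>w\<close> (indexed by \<open>u\<close>, \<open>v\<close>, \<open>w\<close>) the matrix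
  \<open>A\<close> depends on the rows \<open>a\<close>, \<open>b\<close> of \<open>u\<close>, \<open>v\<close> only through \<open>a + b\<close>, which enters \<open>T\<close>, and
  through \<open>a - b\<close>, which enters the Schur complement of the index \<open>v\<close>.\<close>

lemma resolvent_split_pair:
  fixes A T :: "'a \<Rightarrow> 'a \<Rightarrow> real"
  assumes fin: "finite W" and uv: "u \<notin> W" "v \<notin> W" "u \<noteq> v"
    and A: "A u u = 0" "A v v = 0" "A u v = e" "A v u = e"
    and a: "\<And>i. i \<in> W \<Longrightarrow> A u i = a i" "\<And>i. i \<in> W \<Longrightarrow> A i u = a i"
    and b: "\<And>i. i \<in> W \<Longrightarrow> A v i = b i" "\<And>i. i \<in> W \<Longrightarrow> A i v = b i"
    and C: "C = (\<lambda>i j. if i = u then (if j = u then e else (a j + b j) / 2)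
                    else if j = u then a i + b i else A i j)"
    and T: "left_inverse_on (insert u W) T (\<lambda>i j. (if i = j then x else 0) - C i j)"
    and P: "\<And>i. P i = (\<Sum>k\<in>W. T i k * (a k - b k))"
    and Q: "\<And>j. Q j = (\<Sum>k\<in>W. (a k - b k) * T k j)"
    and d: "d = x + e - (\<Sum>k\<in>W. (a k - b k) * P k) / 2" "d \<noteq> 0"
  shows "\<exists>R. left_inverse_on (insert u (insert v W)) R (\<lambda>i j. (if i = j then x else 0) - A i j) \<and>
             (\<Sum>i\<in>insert u (insert v W). R i i) =
               (\<Sum>i\<in>insert u W. T i i) + (1 + (\<Sum>i\<in>insert u W. P i * Q i) / 2) / d"
proof -
  define V where "V = insert u W"
  \<comment> \<open>\<open>N\<close> is \<open>xI - A\<close> in the new basis. The basis vectors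
    are not normalized, hence the factor 1/2 in rows \<open>u\<close> and \<open>v\<close> but not
    in the columns. The two vectors do not couple to each other, and the edge \<open>e\<close>
    contributes \<open>e\<close> to the first diagonal entry of \<open>A\<close> and
    \<open>- e\<close> to the second.\<close>
  define N where "N = (\<lambda>i j. if i = v then (if j = v then x + e else if j = u then 0 else - (a j - b j) / 2)
    else if j = v then (if i = u then 0 else - (a i - b i)) else (if i = j then x else 0) - C i j)"
  have V: "finite V" "v \<notin> V" using fin uv by (auto simp: V_def)
  have neW: "k \<noteq> u" "k \<noteq> v" if "k \<in> W" for k using that uv by auto
  have "left_inverse_on V T (\<lambda>i j. (if i = j then x else 0) - C i j) \<longleftrightarrow> left_inverse_on V T N"
    using V(2) by (intro left_inverse_on_cong) (auto simp: N_def)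
  then have TN: "left_inverse_on V T N" using T by (simp add: V_def)
  have p: "- P i = (\<Sum>k\<in>V. T i k * N k v)" for i
    using fin uv by (simp add: V_def N_def P neW sum_negf[symmetric] algebra_simps cong: sum.cong)
  have q: "- Q j / 2 = (\<Sum>k\<in>V. N v k * T k j)" for j
  proof -
    have "(\<Sum>k\<in>V. N v k * T k j) = (\<Sum>k\<in>W. - ((a k - b k) * T k j / 2))"
      using fin uv unfolding V_def
      by (subst sum.insert) (auto simp: N_def neW field_simps intro!: sum.cong)
    then show ?thesis by (simp add: Q sum_negf sum_divide_distrib)
  qed
  have d': "d = N v v - (\<Sum>k\<in>V. N v k * - P k)"
  proof -
    have "(\<Sum>k\<in>V. N v k * - P k) = (\<Sum>k\<in>W. (a k - b k) * P k / 2)"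
      using fin uv unfolding V_def
      by (subst sum.insert) (auto simp: N_def neW field_simps intro!: sum.cong)
    then show ?thesis by (simp add: d N_def sum_divide_distrib)
  qed
  define RB where "RB = (\<lambda>i j. if i = v then (if j = v then 1 / d else - (- Q j / 2) / d)
                  else if j = v then - (- P i) / d else T i j + (- P i) * (- Q j / 2) / d)"
  have RB: "left_inverse_on (insert v V) RB N"
    by (rule schur_complement_left_inverse(1)[OF V TN p q d' d(2) RB_def])
  have tr: "(\<Sum>i\<in>insert v V. RB i i) = (\<Sum>i\<in>V. T i i) + (1 + (\<Sum>i\<in>V. P i * Q i) / 2) / d"
    using schur_complement_left_inverse(2)[OF V TN p q d' d(2) RB_def] by (simp add: sum_divide_distrib)
  \<comment> \<open>With \<open>S\<close> the matrix whose columns are the new basis vectors,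
    \<open>X\<close> is \<open>S RB\<close> and \<open>R\<close> is
    \<open>S RB S\<^sup>-\<^sup>1\<close>, so the trace of \<open>RB\<close> is kept.\<close>
  define X where "X = (\<lambda>i l. if i = u then RB u l + RB v l else if i = v then RB u l - RB v l else RB i l)"
  define R where "R = (\<lambda>i j. if j = u then (X i u + X i v) / 2
                       else if j = v then (X i u - X i v) / 2 else X i j)"
  have split: "sum f (insert u (insert v W)) = f u + f v + sum f W" for f :: "'a \<Rightarrow> real"
    using fin uv by simp
  have VV: "insert v V = insert u (insert v W)" by (auto simp: V_def)
  have RBN: "(\<Sum>k\<in>insert u (insert v W). RB i k * N k j) = (if i = j then 1 else 0)"
    if "i \<in> insert u (insert v W)" "j \<in> insert u (insert v W)" for i j
    using RB that unfolding left_inverse_on_def VV by blast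
  have XN: "(\<Sum>k\<in>insert u (insert v W). X i k * N k j) =
      (if i = u then of_bool (j = u) + of_bool (j = v)
       else if i = v then of_bool (j = u) - of_bool (j = v) else of_bool (i = j))"
    if "i \<in> insert u (insert v W)" "j \<in> insert u (insert v W)" for i j
  proof -
    have "(\<Sum>k\<in>insert u (insert v W). X i k * N k j) =
      (if i = u then (\<Sum>k\<in>insert u (insert v W). RB u k * N k j) + (\<Sum>k\<in>insert u (insert v W). RB v k * N k j)
       else if i = v then (\<Sum>k\<in>insert u (insert v W). RB u k * N k j) - (\<Sum>k\<in>insert u (insert v W). RB v k * N k j)
       else (\<Sum>k\<in>insert u (insert v W). RB i k * N k j))"
      unfolding X_def by (auto simp: distrib_right left_diff_distrib sum.distrib sum_subtractf simp del: sum.insert)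
    moreover have "(\<Sum>k\<in>insert u (insert v W). RB u k * N k j) = (if u = j then 1 else 0)"
      "(\<Sum>k\<in>insert u (insert v W). RB v k * N k j) = (if v = j then 1 else 0)"
      using that by (intro RBN; simp)+
    ultimately show ?thesis using uv(3) RBN[OF that] by auto
  qed
  have "left_inverse_on (insert u (insert v W)) R (\<lambda>i j. (if i = j then x else 0) - A i j)"
    unfolding left_inverse_on_def
  proof (intro ballI)
    fix i j assume i: "i \<in> insert u (insert v W)" and j: "j \<in> insert u (insert v W)"
    define Sa where "Sa = (\<Sum>k\<in>W. X i k * a k)"
    define Sb where "Sb = (\<Sum>k\<in>W. X i k * b k)"
    have Nu: "(\<Sum>k\<in>W. X i k * N k u) = - Sa - Sb"
      unfolding Sa_def Sb_def sum_negf[symmetric] sum_subtractf[symmetric]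
      by (intro sum.cong refl) (use uv(3) in \<open>simp add: N_def C neW algebra_simps\<close>)
    have Nv: "(\<Sum>k\<in>W. X i k * N k v) = Sb - Sa"
      unfolding Sa_def Sb_def sum_negf[symmetric] sum_subtractf[symmetric]
      by (intro sum.cong refl) (use uv(3) in \<open>simp add: N_def neW algebra_simps\<close>)
    \<comment> \<open>\<open>eu\<close> and \<open>ev\<close> are columns \<open>u\<close> and
      \<open>v\<close> of \<open>X N = S\<close>. Columns \<open>u\<close> and \<open>v\<close> of
      \<open>R (xI - A)\<close> are half their sum and half their difference.\<close>
    have eu: "X i u * (x - e) - Sa - Sb = (if i = u \<or> i = v then 1 else 0)"
      using XN[OF i, of u] uv(3) unfolding split Nu by (simp add: N_def C split: if_splits)
    have ev: "X i v * (x + e) + Sb - Sa = (if i = u then 1 else if i = v then - 1 else 0)"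
      using XN[OF i, of v] uv(3) unfolding split Nv by (simp add: N_def C split: if_splits)
    show "(\<Sum>k\<in>insert u (insert v W). R i k * ((if k = j then x else 0) - A k j)) = (if i = j then 1 else 0)"
    proof -
      consider "j = u" | "j = v" | "j \<in> W" using j by auto
      then show ?thesis
      proof cases
        case 1
        have "(\<Sum>k\<in>W. R i k * ((if k = j then x else 0) - A k j)) = - Sa"
          unfolding Sa_def sum_negf[symmetric] by (intro sum.cong) (auto simp: R_def 1 neW a)
        then have "2 * (\<Sum>k\<in>insert u (insert v W). R i k * ((if k = j then x else 0) - A k j))
           = (X i u * (x - e) - Sa - Sb) + (X i v * (x + e) + Sb - Sa)"
          using uv(3) unfolding split by (simp add: R_def 1 A field_simps)
        then show ?thesis unfolding eu ev using uv(3) 1 by (simp split: if_splits)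
      next
        case 2
        have "(\<Sum>k\<in>W. R i k * ((if k = j then x else 0) - A k j)) = - Sb"
          unfolding Sb_def sum_negf[symmetric] by (intro sum.cong) (auto simp: R_def 2 neW b)
        then have "2 * (\<Sum>k\<in>insert u (insert v W). R i k * ((if k = j then x else 0) - A k j))
           = (X i u * (x - e) - Sa - Sb) - (X i v * (x + e) + Sb - Sa)"
          using uv(3) unfolding split by (simp add: R_def 2 A field_simps)
        then show ?thesis unfolding eu ev using uv(3) 2 by (simp split: if_splits)
      next
        case 3
        have "(\<Sum>k\<in>W. R i k * ((if k = j then x else 0) - A k j)) = (\<Sum>k\<in>W. X i k * N k j)"
          using 3 by (intro sum.cong) (auto simp: R_def N_def C neW)
        then have "(\<Sum>k\<in>insert u (insert v W). R i k * ((if k = j then x else 0) - A k j))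
           = (\<Sum>k\<in>insert u (insert v W). X i k * N k j)"
          using uv 3 neW[OF 3] unfolding split by (simp add: R_def N_def C a b field_simps)
        then show ?thesis using XN[OF i j] uv neW[OF 3] by (simp split: if_splits)
      qed
    qed
  qed
  moreover have "(\<Sum>i\<in>insert u (insert v W). R i i) = (\<Sum>i\<in>insert v V. RB i i)"
  proof -
    have "(\<Sum>i\<in>W. R i i) = (\<Sum>i\<in>W. RB i i)" by (intro sum.cong) (auto simp: R_def X_def neW)
    then show ?thesis using uv(3) unfolding VV split by (simp add: R_def X_def field_simps)
  qed
  ultimately show ?thesis using tr unfolding V_def by auto
qed

text \<open>Both orientations of an edge are moved, which keeps the arc relation symmetric.
  Excluding \<open>w = u\<close> leaves an edge between \<open>u\<close> and \<open>v\<close> in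
  place instead of turning it into a loop.\<close>

definition kelmans :: "'a \<Rightarrow> 'a \<Rightarrow> 'a pair_pre_digraph \<Rightarrow> 'a pair_pre_digraph" where
  "kelmans u v G =
     (let M = {w. (v, w) \<in> parcs G \<and> w \<noteq> u \<and> (u, w) \<notin> parcs G}
      in \<lparr> pverts = pverts G,
           parcs = (parcs G - ({v} \<times> M \<union> M \<times> {v})) \<union> ({u} \<times> M \<union> M \<times> {u}) \<rparr>)"

lemma pverts_kelmans [simp]: "pverts (kelmans u v G) = pverts G"
  by (simp add: kelmans_def Let_def)

lemma pair_graphI:
  assumes "finite (pverts G)" "parcs G \<subseteq> pverts G \<times> pverts G" "sym (parcs G)" "irrefl (parcs G)"
  shows "pair_graph G"
proof -
  have "finite (parcs G)" using assms(1,2) finite_subset by blast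
  then show ?thesis
    using assms by unfold_locales (auto simp: symmetric_def irrefl_def)
qed

lemma pair_graphD:
  assumes "pair_graph G"
  shows "finite (pverts G)" "parcs G \<subseteq> pverts G \<times> pverts G" "sym (parcs G)" "irrefl (parcs G)"
proof -
  interpret pair_graph G by fact
  show "finite (pverts G)" by (rule pair_finite_verts)
  show "parcs G \<subseteq> pverts G \<times> pverts G" using in_arcsD1 in_arcsD2 by auto
  show "sym (parcs G)" using arcs_symmetric by (auto simp: sym_def)
  show "irrefl (parcs G)" using pair_no_loops by (force simp: irrefl_def)
qed

lemma pair_graph_kelmans:
  assumes G: "pair_graph G" and u: "u \<in> pverts G"
  shows "pair_graph (kelmans u v G)"
proof (rule pair_graphI)
  note g = pair_graphD[OF G]
  show "finite (pverts (kelmans u v G))" using g(1) by simp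
  show "parcs (kelmans u v G) \<subseteq> pverts (kelmans u v G) \<times> pverts (kelmans u v G)"
    using g(2) u by (auto simp: kelmans_def Let_def)
  show "sym (parcs (kelmans u v G))" using g(3) by (auto simp: kelmans_def Let_def sym_def)
  show "irrefl (parcs (kelmans u v G))" using g(4) by (auto simp: kelmans_def Let_def irrefl_def)
qed

text \<open>Degrees are at most \<open>n - 1\<close>, so \<open>nI - A\<close> is strictly
  diagonally dominant with slack 1.\<close>

lemma sum_adj_le:
  assumes "pair_graph G" "i \<in> pverts G"
  shows "(\<Sum>j\<in>pverts G. adj G i j) \<le> real (card (pverts G)) - 1"
proof -
  note g = pair_graphD[OF assms(1)]
  have "(\<Sum>j\<in>pverts G. adj G i j) = adj G i i + (\<Sum>j\<in>pverts G - {i}. adj G i j)"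
    using g(1) assms(2) by (rule sum.remove)
  also have "\<dots> \<le> 0 + (\<Sum>j\<in>pverts G - {i}. 1)"
    using g(4) by (intro add_mono sum_mono) (auto simp: irrefl_def)
  also have "\<dots> = real (card (pverts G)) - 1"
    using g(1) assms(2) card_gt_0_iff[of "pverts G"]
    by (auto simp: card_Diff_singleton of_nat_diff)
  finally show ?thesis .
qed

lemma abs_weighted_sum_le:
  fixes T :: "'a \<Rightarrow> 'a \<Rightarrow> real"
  assumes "\<And>i k. i \<in> U \<Longrightarrow> k \<in> W \<Longrightarrow> 0 \<le> T i k"
  shows "i \<in> U \<Longrightarrow> \<bar>\<Sum>k\<in>W. T i k * c k\<bar> \<le> (\<Sum>k\<in>W. T i k * \<bar>c k\<bar>)"
  by (rule order_trans[OF sum_abs]) (auto intro!: sum_mono simp: abs_mult assms)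

text \<open>Moving the private neighbours of \<open>v\<close> to \<open>u\<close> replaces \<open>c = a - b\<close> by \<open>\<bar>c\<bar>\<close> and fixes \<open>T\<close>,
  which is entrywise nonnegative.\<close>

lemma kelmans_resolvent_energy_less:
  assumes G: "pair_graph G" and u: "u \<in> pverts G" and v: "v \<in> pverts G" and "u \<noteq> v"
    and i: "(u, i0) \<in> parcs G" "i0 \<noteq> v" "(v, i0) \<notin> parcs G"
    and j: "(v, j0) \<in> parcs G" "j0 \<noteq> u" "(u, j0) \<notin> parcs G"
  shows "resolvent_energy G < resolvent_energy (kelmans u v G)"
proof -
  note g = pair_graphD[OF G]
  have G': "pair_graph (kelmans u v G)" by (rule pair_graph_kelmans[OF G u])
  note g' = pair_graphD[OF G']
  define W where "W = pverts G - {u, v}"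
  define x where "x = real (card (pverts G))"
  have V: "pverts G = insert u (insert v W)" using u v by (auto simp: W_def)
  have W: "finite W" "u \<notin> W" "v \<notin> W" using g(1) by (auto simp: W_def)
  have irr: "(k, k) \<notin> parcs G" for k using g(4) by (auto simp: irrefl_def)
  have symG: "(k, l) \<in> parcs G \<longleftrightarrow> (l, k) \<in> parcs G" for k l using g(3) by (auto simp: sym_def)
  have i0W: "i0 \<in> W" and j0W: "j0 \<in> W"
    using i j g(2) irr by (auto simp: W_def)
  define e where "e = adj G u v"
  define a where "a k = adj G u k" for k
  define b where "b k = adj G v k" for k
  \<comment> \<open>On \<open>W\<close> these are the rows of \<open>u\<close> and \<open>v\<close>
    after the move: the union and the intersection of the two neighbourhoods. The sum is kept and
    the difference becomes its absolute value.\<close>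
  define a' where "a' k = max (a k) (b k)" for k
  define b' where "b' k = min (a k) (b k)" for k
  have ab: "a' k + b' k = a k + b k" "a' k - b' k = \<bar>a k - b k\<bar>" for k
    by (auto simp: a'_def b'_def)
  define C where "C = (\<lambda>i j. if i = u then (if j = u then e else (a j + b j) / 2)
                    else if j = u then a i + b i else adj G i j)"
  have split: "sum f (insert u W) = f u + sum f W" for f :: "'a \<Rightarrow> real"
    using W by simp
  have deg: "adj G k u + adj G k v + (\<Sum>l\<in>W. adj G k l) \<le> x - 1" if "k \<in> pverts G" for k
    using sum_adj_le[OF G that] W \<open>u \<noteq> v\<close> unfolding V x_def[symmetric, unfolded V]
    by (simp del: sum_of_bool_eq)
  \<comment> \<open>Row \<open>u\<close> of \<open>C\<close> averages the rows of \<open>u\<close>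
    and \<open>v\<close>, and every other row adds the columns of \<open>u\<close> and
    \<open>v\<close>; the degree bound survives both.\<close>
  have row: "(\<Sum>l\<in>insert u W. C k l) \<le> x - 1" if k: "k \<in> insert u W" for k
  proof (cases "k = u")
    case True
    have "(\<Sum>l\<in>W. C u l) = (\<Sum>l\<in>W. (adj G u l + adj G v l) / 2)"
      using W by (intro sum.cong) (auto simp: C_def a_def b_def)
    also have "\<dots> = ((\<Sum>l\<in>W. adj G u l) + (\<Sum>l\<in>W. adj G v l)) / 2"
      by (simp add: sum.distrib sum_divide_distrib add_divide_distrib)
    finally show ?thesis
      using deg[OF u] deg[OF v] unfolding True split by (simp add: C_def e_def irr symG[of v u] field_simps)
  next
    case False
    then have kW: "k \<in> W" using k by auto
    have "(\<Sum>l\<in>W. C k l) = (\<Sum>l\<in>W. adj G k l)"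
      using W False by (intro sum.cong) (auto simp: C_def)
    then show ?thesis
      using deg[of k] kW False unfolding split by (simp add: C_def V a_def b_def symG[of _ k])
  qed
  have Cpos: "0 \<le> C k l" for k l by (simp add: C_def a_def b_def e_def)
  have finU: "finite (insert u W)" using W by simp
  obtain T where T: "left_inverse_on (insert u W) T (\<lambda>i j. (if i = j then x else 0) - C i j)"
    and pos: "\<And>i j. i \<in> insert u W \<Longrightarrow> j \<in> insert u W \<Longrightarrow> 0 \<le> T i j"
    using M_matrix_left_inverse[OF finU, of C x] Cpos row by force
  \<comment> \<open>The row sums of \<open>xI - C\<close> are at least 1 and \<open>T\<close> is
    nonnegative, so the row sums of \<open>T\<close> are at most those of
    \<open>T (xI - C) = I\<close>.\<close>
  have T1: "(\<Sum>l\<in>insert u W. T k l) \<le> 1" if k: "k \<in> insert u W" for k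
  proof -
    have "(\<Sum>l\<in>insert u W. T k l) = (\<Sum>l\<in>insert u W. T k l * 1)" by simp
    also have "\<dots> \<le> (\<Sum>l\<in>insert u W. T k l * (\<Sum>m\<in>insert u W. (if l = m then x else 0) - C l m))"
    proof (intro sum_mono mult_left_mono pos k)
      fix l assume l: "l \<in> insert u W"
      have "(\<Sum>m\<in>insert u W. (if l = m then x else 0) - C l m) = x - (\<Sum>m\<in>insert u W. C l m)"
        using l finU unfolding sum_subtractf by (subst sum.delta') auto
      then show "1 \<le> (\<Sum>m\<in>insert u W. (if l = m then x else 0) - C l m)" using row[OF l] by simp
    qed
    also have "\<dots> = (\<Sum>m\<in>insert u W. \<Sum>l\<in>insert u W. T k l * ((if l = m then x else 0) - C l m))"
      unfolding sum_distrib_left by (rule sum.swap)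
    also have "\<dots> = (\<Sum>m\<in>insert u W. if k = m then 1 else 0)"
      using T k by (intro sum.cong) (auto simp: left_inverse_on_def simp del: sum.insert)
    also have "\<dots> = 1" using k finU by (subst sum.delta') auto
    finally show ?thesis .
  qed
  define P where "P i = (\<Sum>k\<in>W. T i k * (a k - b k))" for i
  define Q where "Q j = (\<Sum>k\<in>W. (a k - b k) * T k j)" for j
  define d where "d = x + e - (\<Sum>k\<in>W. (a k - b k) * P k) / 2"
  define P' where "P' i = (\<Sum>k\<in>W. T i k * (a' k - b' k))" for i
  define Q' where "Q' j = (\<Sum>k\<in>W. (a' k - b' k) * T k j)" for j
  define d' where "d' = x + e - (\<Sum>k\<in>W. (a' k - b' k) * P' k) / 2"
  have c1: "\<bar>a k - b k\<bar> \<le> 1" for k by (simp add: a_def b_def)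
  have PP: "\<bar>P i\<bar> \<le> P' i" if "i \<in> insert u W" for i
    unfolding P_def P'_def ab by (rule abs_weighted_sum_le[OF pos that]) auto
  have QQ: "\<bar>Q i\<bar> \<le> Q' i" if "i \<in> insert u W" for i
    unfolding Q_def Q'_def ab mult.commute[of _ "T _ i"]
    using abs_weighted_sum_le[of "insert u W" W "\<lambda>i k. T k i"] pos that by simp
  have P'1: "P' k \<le> 1" if "k \<in> W" for k
  proof -
    have "P' k \<le> (\<Sum>l\<in>W. T k l * 1)"
      unfolding P'_def ab using that by (intro sum_mono mult_left_mono c1 pos) auto
    also have "\<dots> \<le> (\<Sum>l\<in>insert u W. T k l)"
      using pos[of k u] that unfolding split by simp
    finally show ?thesis using T1[of k] that by simp
  qed
  \<comment> \<open>Each of the \<open>x - 2\<close> terms is at most 1, so \<open>d'\<close> is at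
    least \<open>x - (x - 2) / 2 > 0\<close>.\<close>
  have "(\<Sum>k\<in>W. (a' k - b' k) * P' k) \<le> (\<Sum>k\<in>W. 1 * 1)"
  proof (rule sum_mono)
    fix k assume k: "k \<in> W"
    have "0 \<le> P' k" using PP[of k] k by simp
    then show "(a' k - b' k) * P' k \<le> 1 * 1"
      unfolding ab using c1 P'1[OF k] by (intro mult_mono) auto
  qed
  also have "\<dots> = x - 2" using W \<open>u \<noteq> v\<close> by (simp add: x_def V)
  finally have "(\<Sum>k\<in>W. (a' k - b' k) * P' k) \<le> x - 2" .
  moreover have "0 \<le> x" "0 \<le> e" by (auto simp: x_def e_def)
  ultimately have d'_pos: "0 < d'" unfolding d'_def by simp
  \<comment> \<open>The source of strictness. The identity \<open>x T = I + T C\<close> carries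
    positivity from the diagonal entry at \<open>i0\<close> along the walk \<open>i0\<close>,
    \<open>u\<close>, \<open>j0\<close> in the support of \<open>C\<close>.\<close>
  have T_pos: "0 < T i0 j0"
  proof -
    have step: "x * T k l = (if k = l then 1 else 0) + (\<Sum>m\<in>insert u W. T k m * C m l)"
      if "k \<in> insert u W" "l \<in> insert u W" for k l
    proof -
      have "(if k = l then 1 else 0) = (\<Sum>m\<in>insert u W. T k m * ((if m = l then x else 0) - C m l))"
        by (rule left_inverse_onD[OF T that, symmetric])
      also have "\<dots> = (\<Sum>m\<in>insert u W. (if m = l then T k m * x else 0) - T k m * C m l)"
        by (intro sum.cong) (auto simp: algebra_simps)
      also have "\<dots> = T k l * x - (\<Sum>m\<in>insert u W. T k m * C m l)"
        using that finU unfolding sum_subtractf by (subst sum.delta) auto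
      finally show ?thesis by (simp add: mult.commute)
    qed
    have ge: "T k m * C m l \<le> x * T k l"
      if "k \<in> insert u W" "l \<in> insert u W" "m \<in> insert u W" for k l m
    proof -
      have "T k m * C m l \<le> (\<Sum>m\<in>insert u W. T k m * C m l)"
        using that finU pos Cpos by (intro member_le_sum) auto
      then show ?thesis using step[OF that(1,2)] by (simp split: if_splits)
    qed
    have x: "x > 0" using g(1) u by (auto simp: x_def card_gt_0_iff)
    have "1 \<le> x * T i0 i0"
      using step[of i0 i0] i0W sum_nonneg[of "insert u W" "\<lambda>m. T i0 m * C m i0"] pos Cpos by simp
    then have "0 < x * T i0 i0" by linarith
    then have "0 < T i0 i0" using x by (simp add: zero_less_mult_iff)
    moreover have "C i0 u > 0" using i i0W W by (auto simp: C_def a_def b_def)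
    ultimately have "0 < T i0 i0 * C i0 u" by simp
    also have "\<dots> \<le> x * T i0 u" by (rule ge) (use i0W in simp_all)
    finally have "0 < x * T i0 u" .
    then have "0 < T i0 u" using x by (simp add: zero_less_mult_iff)
    moreover have "C u j0 > 0" using j j0W W by (auto simp: C_def a_def b_def)
    ultimately have "0 < T i0 u * C u j0" by simp
    also have "\<dots> \<le> x * T i0 j0" by (rule ge) (use i0W j0W in simp_all)
    finally have "0 < x * T i0 j0" .
    then show ?thesis using x by (simp add: zero_less_mult_iff)
  qed
  have ci: "a i0 - b i0 = 1" "a j0 - b j0 = -1" using i j by (auto simp: a_def b_def)
  \<comment> \<open>The coefficient at \<open>j0\<close> changes from -1 to 1 and has the positive
    weight \<open>T i0 j0\<close>. As the coefficient at \<open>i0\<close> is 1, the gain reaches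
    the sum in \<open>d\<close>.\<close>
  have "P i0 < P' i0"
    unfolding P_def P'_def
  proof (rule sum_strict_mono_ex1)
    show "\<forall>k\<in>W. T i0 k * (a k - b k) \<le> T i0 k * (a' k - b' k)"
      using pos i0W unfolding ab by (auto intro!: mult_left_mono)
    show "\<exists>k\<in>W. T i0 k * (a k - b k) < T i0 k * (a' k - b' k)"
      using T_pos j0W ci unfolding ab by (intro bexI[of _ j0]) auto
  qed (use W in auto)
  then have "(\<Sum>k\<in>W. (a k - b k) * P k) < (\<Sum>k\<in>W. (a' k - b' k) * P' k)"
  proof (intro sum_strict_mono_ex1 ballI)
    show "(a k - b k) * P k \<le> (a' k - b' k) * P' k" if "k \<in> W" for k
    proof -
      have "(a k - b k) * P k \<le> \<bar>a k - b k\<bar> * \<bar>P k\<bar>" by (metis abs_ge_self abs_mult)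
      also have "\<dots> \<le> \<bar>a k - b k\<bar> * P' k" using PP[of k] that by (intro mult_left_mono) auto
      finally show ?thesis unfolding ab .
    qed
    show "\<exists>k\<in>W. (a k - b k) * P k < (a' k - b' k) * P' k"
      using \<open>P i0 < P' i0\<close> i0W ci unfolding ab by (intro bexI[of _ i0]) auto
  qed (use W in auto)
  then have dd: "d' < d" by (simp add: d_def d'_def)
  have num: "(\<Sum>i\<in>insert u W. P i * Q i) \<le> (\<Sum>i\<in>insert u W. P' i * Q' i)"
  proof (rule sum_mono)
    fix k assume k: "k \<in> insert u W"
    have "P k * Q k \<le> \<bar>P k\<bar> * \<bar>Q k\<bar>" by (metis abs_ge_self abs_mult)
    also have "\<dots> \<le> P' k * Q' k"
      using PP[OF k] QQ[OF k] by (intro mult_mono) auto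
    finally show "P k * Q k \<le> P' k * Q' k" .
  qed
  have num': "0 \<le> (\<Sum>i\<in>insert u W. P' i * Q' i)"
  proof (rule sum_nonneg)
    fix k assume "k \<in> insert u W"
    then have "0 \<le> P' k" "0 \<le> Q' k" using PP[of k] QQ[of k] by auto
    then show "0 \<le> P' k * Q' k" by simp
  qed
  have adjG: "adj G u k = a k" "adj G k u = a k" "adj G v k = b k" "adj G k v = b k" for k
    by (auto simp: a_def b_def symG[of k])
  have adjG': "adj G u u = 0" "adj G v v = 0" "adj G u v = e" "adj G v u = e"
    by (auto simp: e_def irr symG[of v u])
  obtain R where R: "left_inverse_on (pverts G) R (\<lambda>i j. (if i = j then x else 0) - adj G i j)"
    "(\<Sum>i\<in>pverts G. R i i) = (\<Sum>i\<in>insert u W. T i i) + (1 + (\<Sum>i\<in>insert u W. P i * Q i) / 2) / d"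
    using resolvent_split_pair[OF W \<open>u \<noteq> v\<close> adjG' adjG C_def T P_def Q_def d_def, folded V] dd d'_pos
    by force
  let ?H = "kelmans u v G"
  have adjH: "adj ?H u k = a' k" "adj ?H k u = a' k" "adj ?H v k = b' k" "adj ?H k v = b' k" if "k \<in> W" for k
    using that W \<open>u \<noteq> v\<close> irr symG[of k u] symG[of k v]
    by (auto simp: kelmans_def Let_def a'_def b'_def a_def b_def)
  have adjH': "(k, l) \<in> parcs ?H \<longleftrightarrow> (k, l) \<in> parcs G" if "k \<in> W" "l \<in> W" for k l
    using that W by (auto simp: kelmans_def Let_def)
  have adjH'': "adj ?H u u = 0" "adj ?H v v = 0" "adj ?H u v = e" "adj ?H v u = e"
    using W \<open>u \<noteq> v\<close> irr symG[of v u] by (auto simp: kelmans_def Let_def e_def)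
  define C' where "C' = (\<lambda>i j. if i = u then (if j = u then e else (a' j + b' j) / 2)
                    else if j = u then a' i + b' i else adj ?H i j)"
  \<comment> \<open>\<open>C\<close> and \<open>C'\<close> agree on \<open>insert u W\<close>, so
    the same \<open>T\<close> serves both graphs and only the last fraction of the trace
    differs.\<close>
  have "left_inverse_on (insert u W) T (\<lambda>i j. (if i = j then x else 0) - C i j) \<longleftrightarrow>
        left_inverse_on (insert u W) T (\<lambda>i j. (if i = j then x else 0) - C' i j)"
    by (intro left_inverse_on_cong) (auto simp: C_def C'_def ab adjH')
  then have "left_inverse_on (insert u W) T (\<lambda>i j. (if i = j then x else 0) - C' i j)" using T by simp
  then obtain R' where R': "left_inverse_on (pverts G) R' (\<lambda>i j. (if i = j then x else 0) - adj ?H i j)"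
    "(\<Sum>i\<in>pverts G. R' i i) = (\<Sum>i\<in>insert u W. T i i) + (1 + (\<Sum>i\<in>insert u W. P' i * Q' i) / 2) / d'"
    using resolvent_split_pair[OF W \<open>u \<noteq> v\<close> adjH'' adjH C'_def _ P'_def Q'_def d'_def, folded V] d'_pos
    by force
  have "resolvent_energy G = (\<Sum>i\<in>pverts G. R i i)"
    by (rule resolvent_energy_eq_diag_sum[OF g(1,3) R(1)[unfolded x_def]])
  moreover have "resolvent_energy ?H = (\<Sum>i\<in>pverts G. R' i i)"
    using resolvent_energy_eq_diag_sum[OF g'(1,3), unfolded pverts_kelmans, OF R'(1)[unfolded x_def]] .
  \<comment> \<open>The move does not decrease the numerator and strictly decreases the positive
    denominator.\<close>
  moreover have "(1 + (\<Sum>i\<in>insert u W. P i * Q i) / 2) / d < (1 + (\<Sum>i\<in>insert u W. P' i * Q' i) / 2) / d'"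
  proof -
    have "(1 + (\<Sum>i\<in>insert u W. P i * Q i) / 2) / d \<le> (1 + (\<Sum>i\<in>insert u W. P' i * Q' i) / 2) / d"
      using num dd d'_pos by (intro divide_right_mono) auto
    also have "\<dots> < (1 + (\<Sum>i\<in>insert u W. P' i * Q' i) / 2) / d'"
      using num' dd d'_pos by (intro divide_strict_left_mono mult_pos_pos) (auto simp del: sum.insert)
    finally show ?thesis .
  qed
  ultimately show ?thesis using R(2) R'(2) by simp
qed

section \<open>Structure of a maximizer\<close>

lemma tricyclicD:
  assumes "tricyclic G"
  shows "pair_graph G" "card (undirected_edges G) = card (pverts G) + 2"
    "\<And>x y. x \<in> pverts G \<Longrightarrow> y \<in> pverts G \<Longrightarrow> (x, y) \<in> (parcs G)\<^sup>*"
proof -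
  show G: "pair_graph G" and "card (undirected_edges G) = card (pverts G) + 2"
    using assms by (auto simp: tricyclic_def)
  fix x y assume "x \<in> pverts G" "y \<in> pverts G"
  then have "(x, y) \<in> rtrancl_on (pverts G) ((parcs G)\<^sup>s)"
    using assms by (simp add: tricyclic_def connected_conv)
  moreover have "(parcs G)\<^sup>s = parcs G"
    using pair_graphD(3)[OF G] by (auto simp: symcl_def sym_def)
  ultimately show "(x, y) \<in> (parcs G)\<^sup>*" by (metis rtrancl_on_rtranclI)
qed

lemma tricyclicI:
  assumes G: "pair_graph G" and ne: "pverts G \<noteq> {}"
    and conn: "\<And>x y. x \<in> pverts G \<Longrightarrow> y \<in> pverts G \<Longrightarrow> (x, y) \<in> (parcs G)\<^sup>*"
    and "card (undirected_edges G) = card (pverts G) + 2"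
  shows "tricyclic G"
proof -
  note g = pair_graphD[OF G]
  have "(parcs G)\<^sup>s = parcs G" using g(3) by (auto simp: symcl_def sym_def)
  moreover have "(x, y) \<in> rtrancl_on (pverts G) (parcs G)" if "x \<in> pverts G" "y \<in> pverts G" for x y
    using conn[OF that] that g(2) by (intro rtrancl_consistent_rtrancl_on) auto
  ultimately show ?thesis using assms by (simp add: tricyclic_def connected_conv)
qed

lemma in_undirected_edges_iff:
  "sym (parcs G) \<Longrightarrow> {x, y} \<in> undirected_edges G \<longleftrightarrow> (x, y) \<in> parcs G"
  by (auto simp: undirected_edges_def doubleton_eq_iff sym_def)

lemma finite_undirected_edges: "pair_graph G \<Longrightarrow> finite (undirected_edges G)"
  using pair_graphD(1,2)[of G] finite_subset[of "parcs G"] by (auto simp: undirected_edges_def)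

text \<open>The removed edges \<open>X\<close> and the added edges \<open>Y\<close> are both indexed
  by \<open>M\<close>; those in \<open>Y\<close> are new because members of \<open>M\<close> are not
  adjacent to \<open>u\<close>.\<close>

lemma card_undirected_edges_kelmans:
  assumes G: "pair_graph G" and "u \<noteq> v"
  shows "card (undirected_edges (kelmans u v G)) = card (undirected_edges G)"
proof -
  note g = pair_graphD[OF G]
  define M where "M = {w. (v, w) \<in> parcs G \<and> w \<noteq> u \<and> (u, w) \<notin> parcs G}"
  define X where "X = (\<lambda>w. {v, w}) ` M"
  define Y where "Y = (\<lambda>w. {u, w}) ` M"
  have arcs: "parcs (kelmans u v G) = (parcs G - ({v} \<times> M \<union> M \<times> {v})) \<union> ({u} \<times> M \<union> M \<times> {u})"
    by (simp add: kelmans_def Let_def M_def)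
  have X: "{x, y} \<in> X \<longleftrightarrow> (x, y) \<in> {v} \<times> M \<union> M \<times> {v}" for x y
    by (auto simp: X_def doubleton_eq_iff)
  have Y: "{x, y} \<in> Y \<longleftrightarrow> (x, y) \<in> {u} \<times> M \<union> M \<times> {u}" for x y
    by (auto simp: Y_def doubleton_eq_iff)
  have "undirected_edges (kelmans u v G) = (undirected_edges G - X) \<union> Y"
  proof -
    have s: "sym (parcs (kelmans u v G))" using g(3) by (auto simp: arcs sym_def)
    have *: "e \<in> undirected_edges (kelmans u v G) \<longleftrightarrow> e \<in> (undirected_edges G - X) \<union> Y"
      if "e = {x, y}" for e x y
      unfolding that using in_undirected_edges_iff[OF s, of x y] in_undirected_edges_iff[OF g(3), of x y] X[of x y] Y[of x y]
      by (auto simp: arcs)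
    have **: "\<exists>x y. e = {x, y}"
      if "e \<in> undirected_edges (kelmans u v G) \<or> e \<in> (undirected_edges G - X) \<union> Y" for e
      using that by (auto simp: undirected_edges_def Y_def)
    show ?thesis
    proof (rule Set.set_eqI)
      fix e
      show "e \<in> undirected_edges (kelmans u v G) \<longleftrightarrow> e \<in> (undirected_edges G - X) \<union> Y"
      proof (cases "\<exists>x y. e = {x, y}")
        case True
        then obtain x y where "e = {x, y}" by blast
        then show ?thesis by (rule *)
      next
        case False
        then show ?thesis using **[of e] by argo
      qed
    qed
  qed
  moreover have "X \<subseteq> undirected_edges G"
    using in_undirected_edges_iff[OF g(3)] by (auto simp: X_def M_def)
  moreover have "undirected_edges G \<inter> Y = {}"
    using in_undirected_edges_iff[OF g(3)] by (auto simp: Y_def M_def)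
  moreover have "card X = card M" "card Y = card M"
    unfolding X_def Y_def by (auto intro!: card_image inj_onI simp: doubleton_eq_iff)
  moreover have fin: "finite (undirected_edges G)" by (rule finite_undirected_edges[OF G])
  moreover have "M \<subseteq> pverts G" using g(2) by (auto simp: M_def)
  then have "finite M" using g(1) finite_subset by blast
  then have "finite X" "finite Y" by (auto simp: X_def Y_def)
  moreover have "card X \<le> card (undirected_edges G)"
    using \<open>X \<subseteq> _\<close> fin by (rule card_mono[rotated])
  ultimately show ?thesis
    by (simp add: card_Un_disjoint card_Diff_subset Diff_Int_distrib2 Int_Diff disjoint_iff)
qed

text \<open>A walk from \<open>v\<close> to \<open>u\<close> survives the move, and it reroutes each
  lost edge \<open>vw\<close> through the new edge \<open>uw\<close>.\<close>

lemma tricyclic_kelmans: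
  assumes G: "tricyclic G" and u: "u \<in> pverts G" and v: "v \<in> pverts G" and "u \<noteq> v"
    and link: "(u, v) \<in> parcs G \<or> (\<exists>z. (u, z) \<in> parcs G \<and> (v, z) \<in> parcs G)"
  shows "tricyclic (kelmans u v G)"
proof (rule tricyclicI)
  note G' = tricyclicD[OF G]
  note g = pair_graphD[OF G'(1)]
  let ?E = "parcs (kelmans u v G)"
  show H: "pair_graph (kelmans u v G)" by (rule pair_graph_kelmans[OF G'(1) u])
  show "pverts (kelmans u v G) \<noteq> {}" using u by auto
  show "card (undirected_edges (kelmans u v G)) = card (pverts (kelmans u v G)) + 2"
    using card_undirected_edges_kelmans[OF G'(1) \<open>u \<noteq> v\<close>] G'(2) by simp
  have symE: "sym (?E\<^sup>*)" using pair_graphD(3)[OF H] by (rule sym_rtrancl)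
  have vu: "(v, u) \<in> ?E\<^sup>*"
    using link
  proof
    assume "(u, v) \<in> parcs G"
    then have "(v, u) \<in> ?E" using g(3,4) by (auto simp: kelmans_def Let_def sym_def irrefl_def)
    then show ?thesis by blast
  next
    assume "\<exists>z. (u, z) \<in> parcs G \<and> (v, z) \<in> parcs G"
    then obtain z where z: "(u, z) \<in> parcs G" "(v, z) \<in> parcs G" by blast
    \<comment> \<open>A common neighbour \<open>z\<close> is not in \<open>M\<close>, so its edges
      stay.\<close>
    then have "(v, z) \<in> ?E" "(z, u) \<in> ?E"
      using g(3,4) by (auto simp: kelmans_def Let_def sym_def irrefl_def)
    then show ?thesis by (meson converse_rtrancl_into_rtrancl r_into_rtrancl)
  qed
  have sub: "parcs G \<subseteq> ?E\<^sup>*"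
  proof (rule subrelI)
    fix x y assume xy: "(x, y) \<in> parcs G"
    consider "(x, y) \<in> ?E" | "x = v" "(u, y) \<in> ?E" | "y = v" "(x, u) \<in> ?E"
      using xy by (auto simp: kelmans_def Let_def)
    then show "(x, y) \<in> ?E\<^sup>*"
    proof cases
      case 2 then show ?thesis using vu by (meson rtrancl_into_rtrancl)
    next
      case 3 then show ?thesis using vu symE by (metis converse_rtrancl_into_rtrancl symD)
    qed auto
  qed
  show "(x, y) \<in> ?E\<^sup>*" if "x \<in> pverts (kelmans u v G)" "y \<in> pverts (kelmans u v G)" for x y
    using subsetD[OF rtrancl_subset_rtrancl[OF sub] G'(3)[of x y]] that by simp
qed

section \<open>Neighbourhoods in a maximizer\<close>

text \<open>If \<open>i\<close> and \<open>j\<close> were private neighbours of \<open>u\<close> and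
  \<open>v\<close>, the Kelmans move would give a tricyclic graph of larger energy on the same
  vertices.\<close>

lemma max_resolvent_energy_nested:
  assumes G: "tricyclic G"
    and max: "\<And>H. tricyclic H \<Longrightarrow> pverts H = pverts G \<Longrightarrow> resolvent_energy H \<le> resolvent_energy G"
    and "u \<noteq> v"
    and link: "(u, v) \<in> parcs G \<or> (\<exists>z. (u, z) \<in> parcs G \<and> (v, z) \<in> parcs G)"
    and i: "(u, i) \<in> parcs G" "i \<noteq> v" and j: "(v, j) \<in> parcs G" "j \<noteq> u"
  shows "(v, i) \<in> parcs G \<or> (u, j) \<in> parcs G"
proof (rule ccontr)
  assume n: "\<not> ?thesis"
  have uv: "u \<in> pverts G" "v \<in> pverts G" using pair_graphD(2)[OF tricyclicD(1)[OF G]] i j by auto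
  have "resolvent_energy G < resolvent_energy (kelmans u v G)"
    using n i j \<open>u \<noteq> v\<close> by (intro kelmans_resolvent_energy_less[OF tricyclicD(1)[OF G] uv]) auto
  moreover have "tricyclic (kelmans u v G)"
    by (rule tricyclic_kelmans[OF G uv \<open>u \<noteq> v\<close> link])
  ultimately show False using max[of "kelmans u v G"] by simp
qed

lemma max_resolvent_energy_dominating:
  assumes G: "tricyclic G"
    and max: "\<And>H. tricyclic H \<Longrightarrow> pverts H = pverts G \<Longrightarrow> resolvent_energy H \<le> resolvent_energy G"
    and ne: "pverts G \<noteq> {}"
  shows "\<exists>u\<in>pverts G. \<forall>w\<in>pverts G. w \<noteq> u \<longrightarrow> (u, w) \<in> parcs G"
proof -
  note G' = tricyclicD[OF G]
  note g = pair_graphD[OF G'(1)]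
  define Nb where "Nb x = {w. (x, w) \<in> parcs G}" for x
  have fin: "finite (Nb x)" for x
    by (rule finite_subset[OF _ g(1)]) (use g(2) in \<open>auto simp: Nb_def\<close>)
  obtain u where u: "u \<in> pverts G" and deg: "\<And>x. x \<in> pverts G \<Longrightarrow> card (Nb x) \<le> card (Nb u)"
  proof -
    have "Max ((\<lambda>x. card (Nb x)) ` pverts G) \<in> (\<lambda>x. card (Nb x)) ` pverts G"
      using g(1) ne by (intro Max_in) auto
    then obtain u where "u \<in> pverts G" "card (Nb u) = Max ((\<lambda>x. card (Nb x)) ` pverts G)" by auto
    then show thesis using g(1) by (intro that[of u]) (auto intro!: Max_ge)
  qed
  have "(u, w) \<in> parcs G" if w: "w \<in> pverts G" "w \<noteq> u" for w
  proof (rule ccontr)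
    assume nw: "(u, w) \<notin> parcs G"
    \<comment> \<open>On a walk from \<open>u\<close> to \<open>w\<close>, some arc leaves the
      closed neighbourhood of \<open>u\<close>; its tail \<open>z\<close> is a neighbour of
      \<open>u\<close>.\<close>
    have "x \<in> insert u (Nb u) \<or> (\<exists>z y. z \<in> Nb u \<and> (z, y) \<in> parcs G \<and> y \<notin> insert u (Nb u))"
      if "(u, x) \<in> (parcs G)\<^sup>*" for x
      using that by induction (auto simp: Nb_def)
    then obtain z y where z: "(u, z) \<in> parcs G" "(z, y) \<in> parcs G" and y: "y \<noteq> u" "y \<notin> Nb u"
      using G'(3)[OF u w(1)] nw w by (fastforce simp: Nb_def)
    \<comment> \<open>As \<open>y\<close> is a neighbour of \<open>z\<close> but not of
      \<open>u\<close>, nestedness makes every other neighbour of \<open>u\<close> adjacent to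
      \<open>z\<close>. Thus \<open>z\<close> has larger degree than \<open>u\<close>.\<close>
    have sub: "insert u (insert y (Nb u - {z})) \<subseteq> Nb z"
    proof -
      have "u \<in> Nb z" using z g(3) by (auto simp: Nb_def sym_def)
      moreover have "i \<in> Nb z" if "i \<in> Nb u - {z}" for i
        using max_resolvent_energy_nested[OF G max, of u z i y] that z y g(4)
        by (auto simp: Nb_def irrefl_def)
      ultimately show ?thesis using z by (auto simp: Nb_def)
    qed
    have "u \<notin> Nb u" using g(4) by (auto simp: Nb_def irrefl_def)
    moreover have "z \<in> Nb u" using z by (simp add: Nb_def)
    moreover from this have "card (Nb u) > 0" using fin[of u] by (auto simp: card_gt_0_iff)
    ultimately have "card (insert u (insert y (Nb u - {z}))) = card (Nb u) + 1"
      using y fin[of u] by (simp add: card_insert_if)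
    then have "card (Nb z) > card (Nb u)" using card_mono[OF fin sub] by simp
    moreover have "z \<in> pverts G" using z g(2) by auto
    ultimately show False using deg[of z] by simp
  qed
  then show ?thesis using u by blast
qed

text \<open>A dominating vertex \<open>u\<close> uses \<open>n - 1\<close> of the
  \<open>n + 2\<close> edges, which leaves three. Any two other vertices have \<open>u\<close> as a
  common neighbour, so nestedness holds for all of them and makes the three edges meet
  pairwise.\<close>

lemma max_resolvent_energy_structure:
  assumes G: "tricyclic G"
    and max: "\<And>H. tricyclic H \<Longrightarrow> pverts H = pverts G \<Longrightarrow> resolvent_energy H \<le> resolvent_energy G"
    and ne: "pverts G \<noteq> {}"
  obtains
    (triangle) u S where "u \<in> pverts G" "S \<subseteq> pverts G - {u}" "card S = 3"
      "\<And>i j. (i, j) \<in> parcs G \<longleftrightarrow> i \<in> pverts G \<and> j \<in> pverts G \<and> i \<noteq> j \<and>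
                 (i = u \<or> j = u \<or> i \<in> S \<and> j \<in> S)"
  | (star) u c L where "u \<in> pverts G" "c \<in> pverts G - {u}" "L \<subseteq> pverts G - {u, c}" "card L = 3"
      "\<And>i j. (i, j) \<in> parcs G \<longleftrightarrow> i \<in> pverts G \<and> j \<in> pverts G \<and> i \<noteq> j \<and>
                 (i = u \<or> j = u \<or> i = c \<and> j \<in> L \<or> i \<in> L \<and> j = c)"
proof -
  note G' = tricyclicD[OF G]
  note g = pair_graphD[OF G'(1)]
  obtain u where u: "u \<in> pverts G" and dom: "\<And>w. w \<in> pverts G \<Longrightarrow> w \<noteq> u \<Longrightarrow> (u, w) \<in> parcs G"
    using max_resolvent_energy_dominating[OF G max ne] by blast
  have symG: "(k, l) \<in> parcs G \<longleftrightarrow> (l, k) \<in> parcs G" for k l using g(3) by (auto simp: sym_def)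
  have irr: "(k, k) \<notin> parcs G" for k using g(4) by (auto simp: irrefl_def)
  note edge = in_undirected_edges_iff[OF g(3)]
  define F where "F = {e \<in> undirected_edges G. u \<notin> e}"
  have finF: "finite F" using finite_undirected_edges[OF G'(1)] by (simp add: F_def)
  have Fpair: "\<exists>x y. e = {x, y} \<and> x \<noteq> y \<and> x \<noteq> u \<and> y \<noteq> u \<and> (x, y) \<in> parcs G" if "e \<in> F" for e
    using that irr by (auto simp: F_def undirected_edges_def)
  have inF: "{x, y} \<in> F \<longleftrightarrow> (x, y) \<in> parcs G \<and> x \<noteq> u \<and> y \<noteq> u" for x y
    by (auto simp: F_def edge)
  have arcs: "(i, j) \<in> parcs G \<longleftrightarrow> i \<in> pverts G \<and> j \<in> pverts G \<and> i \<noteq> j \<and> (i = u \<or> j = u \<or> {i, j} \<in> F)" for i j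
    using g(2) irr dom symG[of i u] by (auto simp: inF)
  have "undirected_edges G = F \<union> (\<lambda>w. {u, w}) ` (pverts G - {u})"
  proof (intro equalityI subsetI)
    fix e assume e: "e \<in> undirected_edges G"
    then obtain x y where "e = {x, y}" "(x, y) \<in> parcs G" by (auto simp: undirected_edges_def)
    then show "e \<in> F \<union> (\<lambda>w. {u, w}) ` (pverts G - {u})"
      using g(2) irr e by (cases "x = u \<or> y = u") (auto simp: F_def insert_commute)
  qed (auto simp: F_def edge intro: dom)
  moreover have "F \<inter> (\<lambda>w. {u, w}) ` (pverts G - {u}) = {}" by (auto simp: F_def)
  moreover have "card ((\<lambda>w. {u, w}) ` (pverts G - {u})) = card (pverts G) - 1"
    using u g(1) by (subst card_image) (auto intro!: inj_onI simp: doubleton_eq_iff)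
  moreover have "card (pverts G) > 0" using u g(1) by (auto simp: card_gt_0_iff)
  ultimately have F3: "card F = 3"
    using G'(2) g(1) finF by (simp add: card_Un_disjoint)
  \<comment> \<open>For disjoint edges \<open>ab\<close> and \<open>cd\<close>, nestedness of
    \<open>a\<close>, \<open>c\<close> yields \<open>cb\<close> or \<open>ad\<close>, and that of
    \<open>a\<close>, \<open>d\<close> yields \<open>db\<close> or \<open>ac\<close>: four edges
    avoiding \<open>u\<close>.\<close>
  have meet: "e \<inter> f \<noteq> {}" if ef: "e \<in> F" "f \<in> F" for e f
  proof
    assume disj: "e \<inter> f = {}"
    obtain a b where e: "e = {a, b}" "a \<noteq> b" "a \<noteq> u" "b \<noteq> u" "(a, b) \<in> parcs G" using Fpair[OF ef(1)] by blast
    obtain c d where f: "f = {c, d}" "c \<noteq> d" "c \<noteq> u" "d \<noteq> u" "(c, d) \<in> parcs G" using Fpair[OF ef(2)] by blast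
    have ne: "a \<noteq> c" "a \<noteq> d" "b \<noteq> c" "b \<noteq> d" using disj e f by auto
    have cn: "(x, u) \<in> parcs G" if "x \<in> {a, b, c, d}" for x
      using that e f g(2) dom symG[of x u] by auto
    have "(c, b) \<in> parcs G \<or> (a, d) \<in> parcs G"
      using max_resolvent_energy_nested[OF G max, of a c b d] cn[of a] cn[of c] e f ne by auto
    then obtain h where h: "h \<in> F" "h = {c, b} \<or> h = {a, d}"
      using e f inF[of c b] inF[of a d] by blast
    have "(d, b) \<in> parcs G \<or> (a, c) \<in> parcs G"
      using max_resolvent_energy_nested[OF G max, of a d b c] cn[of a] cn[of d] e f ne symG[of c d] by auto
    then obtain k where k: "k \<in> F" "k = {d, b} \<or> k = {a, c}"
      using e f inF[of d b] inF[of a c] by blast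
    have "e \<noteq> f \<and> e \<noteq> h \<and> e \<noteq> k \<and> f \<noteq> h \<and> f \<noteq> k \<and> h \<noteq> k"
      using h(2) k(2) unfolding e(1) f(1)
      by (elim disjE) (simp_all add: doubleton_eq_iff ne ne[symmetric] e(2) f(2) e(2)[symmetric] f(2)[symmetric])
    then have "card {e, f, h, k} = 4" by simp
    moreover have "{e, f, h, k} \<subseteq> F" using ef h k by simp
    ultimately show False using card_mono[OF finF, of "{e, f, h, k}"] F3 by simp
  qed
  obtain e1 e2 e3 where F: "F = {e1, e2, e3}" and ne3: "e1 \<noteq> e2" "e1 \<noteq> e3" "e2 \<noteq> e3"
    using F3 card_3_iff[of F] by auto
  obtain a where a: "a \<in> e1" "a \<in> e2" using meet[of e1 e2] F by auto
  have other: "\<exists>b. e = {a, b} \<and> b \<noteq> a" if "e \<in> F" "a \<in> e" for e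
    using Fpair[OF that(1)] that(2) by (auto simp: insert_commute) 
  obtain b where b: "e1 = {a, b}" "b \<noteq> a" using other[of e1] a F by auto
  obtain c where c: "e2 = {a, c}" "c \<noteq> a" using other[of e2] a F by auto
  have bc: "b \<noteq> c" using ne3 b c by auto
  have memF: "x \<in> pverts G - {u}" if "e \<in> F" "x \<in> e" for e x
    using Fpair[OF that(1)] that(2) g(2) by auto
  show thesis
  \<comment> \<open>Two of the edges are \<open>ab\<close> and \<open>ac\<close>. The third contains
    \<open>a\<close>, giving a star, or must meet them in \<open>b\<close> and \<open>c\<close>,
    giving a triangle.\<close>
  proof (cases "a \<in> e3")
    case True
    obtain d where d: "e3 = {a, d}" "d \<noteq> a" using other[of e3] True F by auto
    have "d \<noteq> b" "d \<noteq> c" using ne3 b c d by auto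
    show thesis
    proof (rule star[of u a "{b, c, d}"])
      show "a \<in> pverts G - {u}" using memF[of e1 a] F a by simp
      show "{b, c, d} \<subseteq> pverts G - {u, a}"
        using memF[of e1 b] memF[of e2 c] memF[of e3 d] F b c d by auto
      show "card {b, c, d} = 3" using \<open>d \<noteq> b\<close> \<open>d \<noteq> c\<close> bc by simp
      show "(i, j) \<in> parcs G \<longleftrightarrow> i \<in> pverts G \<and> j \<in> pverts G \<and> i \<noteq> j \<and>
                 (i = u \<or> j = u \<or> i = a \<and> j \<in> {b, c, d} \<or> i \<in> {b, c, d} \<and> j = a)" for i j
        unfolding arcs[of i j] F b(1) c(1) d(1) by (auto simp: doubleton_eq_iff)
    qed (rule u)
  next
    case False
    have "b \<in> e3" "c \<in> e3" using meet[of e3 e1] meet[of e3 e2] F False b c by auto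
    then have e3: "e3 = {b, c}" using Fpair[of e3] F bc by auto
    show thesis
    proof (rule triangle[of u "{a, b, c}"])
      show "{a, b, c} \<subseteq> pverts G - {u}"
        using memF[of e1 a] memF[of e1 b] memF[of e2 c] F b c by auto
      show "card {a, b, c} = 3" using b c bc by simp
      show "(i, j) \<in> parcs G \<longleftrightarrow> i \<in> pverts G \<and> j \<in> pverts G \<and> i \<noteq> j \<and>
                 (i = u \<or> j = u \<or> i \<in> {a, b, c} \<and> j \<in> {a, b, c})" for i j
        unfolding arcs[of i j] F b(1) c(1) e3 by (auto simp: doubleton_eq_iff)
    qed (rule u)
  qed
qed

section \<open>Energies of the candidates\<close>

text \<open>Both sides have the form \<open>t + (1 + s) / (x - p)\<close>, where \<open>t\<close>,
  \<open>p\<close> and \<open>s\<close> are the trace, the sum of the row sums and the sum of their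
  squares for the resolvent without the dominating vertex. The triangle has the larger
  \<open>t\<close> and no smaller \<open>p\<close> and \<open>s\<close>.\<close>

lemma star_triangle_inequality:
  fixes x :: real
  assumes x: "5 \<le> x" and g: "g = 1 / (x\<^sup>2 - 3)"
  shows "(x * g + 3 * ((1 + g) / x) + (x - 5) / x) +
         (1 + ((x + 3)\<^sup>2 * g\<^sup>2 + 3 * ((x + 1)\<^sup>2 * g\<^sup>2) + (x - 5) / x\<^sup>2)) /
           (x - ((x + 3) * g + 3 * ((x + 1) * g) + (x - 5) / x))
       < (3 * ((x - 1) / ((x + 1) * (x - 2))) + (x - 4) / x) +
         (1 + (3 / (x - 2)\<^sup>2 + (x - 4) / x\<^sup>2)) / (x - (3 / (x - 2) + (x - 4) / x))"
proof -
  have pos: "0 < x" "0 < x - 2" "0 < x + 1" using x by auto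
  have "25 \<le> x\<^sup>2" using power_mono[OF x, of 2] by simp
  then have pos3: "0 < x\<^sup>2 - 3" by simp
  have 1: "x * g + 3 * ((1 + g) / x) + (x - 5) / x < 3 * ((x - 1) / ((x + 1) * (x - 2))) + (x - 4) / x"
  proof -
    have "3 * ((x - 1) / ((x + 1) * (x - 2))) + (x - 4) / x - (x * g + 3 * ((1 + g) / x) + (x - 5) / x)
       = (3 * (x - 1) * x * (x\<^sup>2 - 3) + ((x - 4) - (x - 5) - 3) * ((x + 1) * (x - 2)) * (x\<^sup>2 - 3)
            - (x\<^sup>2 + 3) * ((x + 1) * (x - 2))) / ((x + 1) * (x - 2) * x * (x\<^sup>2 - 3))"
      using pos pos3 by (simp add: g divide_simps) (simp add: algebra_simps power2_eq_square)
    also have "3 * (x - 1) * x * (x\<^sup>2 - 3) + ((x - 4) - (x - 5) - 3) * ((x + 1) * (x - 2)) * (x\<^sup>2 - 3)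
            - (x\<^sup>2 + 3) * ((x + 1) * (x - 2)) = 6 * (x - 1)"
      by (simp add: algebra_simps power2_eq_square)
    also have "6 * (x - 1) / ((x + 1) * (x - 2) * x * (x\<^sup>2 - 3)) > 0"
      using pos pos3 x by (intro divide_pos_pos mult_pos_pos) auto
    finally show ?thesis by simp
  qed
  have 2: "(x + 3) * g + 3 * ((x + 1) * g) + (x - 5) / x \<le> 3 / (x - 2) + (x - 4) / x"
  proof -
    have "3 / (x - 2) + (x - 4) / x - ((x + 3) * g + 3 * ((x + 1) * g) + (x - 5) / x)
       = 6 / (x * (x - 2) * (x\<^sup>2 - 3))"
      using pos pos3 by (simp add: g divide_simps) (simp add: algebra_simps power2_eq_square)
    also have "\<dots> > 0" using pos pos3 by (intro divide_pos_pos mult_pos_pos) auto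
    finally show ?thesis by simp
  qed
  have 3: "(x + 3)\<^sup>2 * g\<^sup>2 + 3 * ((x + 1)\<^sup>2 * g\<^sup>2) + (x - 5) / x\<^sup>2 \<le> 3 / (x - 2)\<^sup>2 + (x - 4) / x\<^sup>2"
  proof -
    have "3 / (x - 2)\<^sup>2 + (x - 4) / x\<^sup>2 - ((x + 3)\<^sup>2 * g\<^sup>2 + 3 * ((x + 1)\<^sup>2 * g\<^sup>2) + (x - 5) / x\<^sup>2)
       = (3 * x\<^sup>2 * (x\<^sup>2 - 3)\<^sup>2 + (x - 2)\<^sup>2 * (x\<^sup>2 - 3)\<^sup>2
          - ((x + 3)\<^sup>2 + 3 * (x + 1)\<^sup>2) * x\<^sup>2 * (x - 2)\<^sup>2) / (x\<^sup>2 * (x - 2)\<^sup>2 * (x\<^sup>2 - 3)\<^sup>2)"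
      using pos pos3 by (simp add: g divide_simps) (simp add: algebra_simps power2_eq_square)
    also have "3 * x\<^sup>2 * (x\<^sup>2 - 3)\<^sup>2 + (x - 2)\<^sup>2 * (x\<^sup>2 - 3)\<^sup>2
          - ((x + 3)\<^sup>2 + 3 * (x + 1)\<^sup>2) * x\<^sup>2 * (x - 2)\<^sup>2 = 12 * (x * (x * (2 * x - 3) - 3) + 3)"
      by (simp add: algebra_simps power2_eq_square)
    also have "12 * (x * (x * (2 * x - 3) - 3) + 3) / (x\<^sup>2 * (x - 2)\<^sup>2 * (x\<^sup>2 - 3)\<^sup>2) \<ge> 0"
    proof -
      \<comment> \<open>The numerator is in Horner form, so positivity is read off from the inside
        out.\<close>
      have "5 * 7 \<le> x * (2 * x - 3)" using x by (intro mult_mono) auto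
      then have "0 \<le> x * (x * (2 * x - 3) - 3)" using x by (intro mult_nonneg_nonneg) auto
      then show ?thesis by (intro divide_nonneg_nonneg) auto
    qed
    finally show ?thesis by simp
  qed
  have 4: "0 < x - (3 / (x - 2) + (x - 4) / x)"
  proof -
    have "3 / (x - 2) \<le> 1" "(x - 4) / x \<le> 1" using x by auto
    then show ?thesis using x by linarith
  qed
  let ?p = "(x + 3) * g + 3 * ((x + 1) * g) + (x - 5) / x"
  let ?s = "(x + 3)\<^sup>2 * g\<^sup>2 + 3 * ((x + 1)\<^sup>2 * g\<^sup>2) + (x - 5) / x\<^sup>2"
  have "0 \<le> 1 + (3 / (x - 2)\<^sup>2 + (x - 4) / x\<^sup>2)" using x by (intro add_nonneg_nonneg) auto
  then have "(1 + ?s) / (x - ?p) \<le> (1 + (3 / (x - 2)\<^sup>2 + (x - 4) / x\<^sup>2)) / (x - (3 / (x - 2) + (x - 4) / x))"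
    using 2 3 4 by (intro frac_le) auto
  then show ?thesis using 1 by linarith
qed

text \<open>Schur complement of \<open>u\<close>, whose coupling to every other vertex is -1, so
  only the row sums of \<open>T\<close> enter. \<open>T\<close> is the resolvent of \<open>G\<close>
  without \<open>u\<close>, but \<open>x\<close> remains the order of \<open>G\<close>.\<close>

lemma resolvent_energy_dominating:
  assumes G: "pair_graph G" and u: "u \<in> pverts G"
    and dom: "\<And>w. w \<in> pverts G \<Longrightarrow> w \<noteq> u \<Longrightarrow> (u, w) \<in> parcs G"
    and W: "W = pverts G - {u}" and x: "x = real (card (pverts G))"
    and T: "left_inverse_on W T (\<lambda>i j. (if i = j then x else 0) - adj G i j)"
    and p: "\<And>i. i \<in> W \<Longrightarrow> (\<Sum>k\<in>W. T i k) = p i"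
    and q: "\<And>j. j \<in> W \<Longrightarrow> (\<Sum>k\<in>W. T k j) = p j"
    and ne: "x - (\<Sum>k\<in>W. p k) \<noteq> 0"
  shows "resolvent_energy G = (\<Sum>i\<in>W. T i i) + (1 + (\<Sum>i\<in>W. (p i)\<^sup>2)) / (x - (\<Sum>k\<in>W. p k))"
proof -
  note g = pair_graphD[OF G]
  define N where "N = (\<lambda>i j. (if i = j then x else 0) - adj G i j)"
  have V: "pverts G = insert u W" using u by (auto simp: W)
  have finW: "finite W" "u \<notin> W" using g(1) by (auto simp: W)
  have Nu: "N k u = -1" "N u k = -1" if "k \<in> W" for k
    using that dom[of k] g(3) by (auto simp: N_def W sym_def)
  have Nuu: "N u u = x" using g(4) by (auto simp: N_def irrefl_def)
  have p': "- p i = (\<Sum>k\<in>W. T i k * N k u)" if "i \<in> W" for i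
    using p[OF that] by (simp add: Nu sum_negf)
  have q': "- p j = (\<Sum>k\<in>W. N u k * T k j)" if "j \<in> W" for j
    using q[OF that] by (simp add: Nu sum_negf)
  have d: "x - (\<Sum>k\<in>W. p k) = N u u - (\<Sum>k\<in>W. N u k * - p k)"
    by (simp add: Nu Nuu)
  define T' where "T' = (\<lambda>i j. if i = u then (if j = u then 1 / (x - (\<Sum>k\<in>W. p k)) else - (- p j) / (x - (\<Sum>k\<in>W. p k)))
     else if j = u then - (- p i) / (x - (\<Sum>k\<in>W. p k))
     else T i j + (- p i) * (- p j) / (x - (\<Sum>k\<in>W. p k)))"
  note S = schur_complement_left_inverse[OF finW T[folded N_def] p' q' d ne T'_def]
  have "resolvent_energy G = (\<Sum>i\<in>pverts G. T' i i)"
    by (rule resolvent_energy_eq_diag_sum[OF g(1,3) S(1)[folded V, unfolded N_def x]])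
  then show ?thesis using S(2)[folded V] by (simp add: power2_eq_square)
qed

text \<open>Without \<open>u\<close> the graph is a triangle and \<open>x - 4\<close> isolated
  vertices, whose resolvent is explicit.\<close>

lemma resolvent_energy_dominating_triangle:
  assumes G: "pair_graph G" and u: "u \<in> pverts G" and S: "S \<subseteq> pverts G - {u}" "card S = 3"
    and arcs: "\<And>i j. (i, j) \<in> parcs G \<longleftrightarrow> i \<in> pverts G \<and> j \<in> pverts G \<and> i \<noteq> j \<and>
                 (i = u \<or> j = u \<or> i \<in> S \<and> j \<in> S)"
    and x: "x = real (card (pverts G))"
  shows "resolvent_energy G = (3 * ((x - 1) / ((x + 1) * (x - 2))) + (x - 4) / x) +
         (1 + (3 / (x - 2)\<^sup>2 + (x - 4) / x\<^sup>2)) / (x - (3 / (x - 2) + (x - 4) / x))"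
proof -
  note g = pair_graphD[OF G]
  define W where "W = pverts G - {u}"
  have finS: "finite S" using S(2) card.infinite by fastforce
  have finW: "finite W" using g(1) by (simp add: W_def)
  have SW: "S \<subseteq> W" using S by (simp add: W_def)
  have "card S \<le> card W" using finW SW by (rule card_mono)
  moreover have cW: "card W = card (pverts G) - 1" using u g(1) by (simp add: W_def)
  ultimately have x4: "4 \<le> x" using S(2) by (simp add: x)
  have cI: "real (card (W - S)) = x - 4"
    using cW S(2) x4 card_Diff_subset[OF finS SW] by (simp add: x)
  have split: "(\<Sum>k\<in>W. f k) = (\<Sum>k\<in>S. f k) + (\<Sum>k\<in>W - S. f k)" for f :: "'a \<Rightarrow> real"
    using sum.subset_diff[OF SW finW, of f] by simp
  \<comment> \<open>On \<open>S\<close> the matrix to invert is \<open>(x + 1)I - J\<close> with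
    \<open>J\<close> the all-one matrix of order 3; Sherman-Morrison gives
    \<open>I / (x + 1) + h J\<close>.\<close>
  define h where "h = 1 / ((x + 1) * (x - 2))"
  define T where "T = (\<lambda>i j. (if i = j then (if i \<in> S then 1 / (x + 1) else 1 / x) else 0)
                         + (if i \<in> S \<and> j \<in> S then h else 0))"
  define p where "p i = (if i \<in> S then 1 / (x - 2) else 1 / x)" for i
  have h: "h * (x - 2) = 1 / (x + 1)" "1 / (x + 1) + 3 * h = 1 / (x - 2)" "1 / (x + 1) + h = (x - 1) / ((x + 1) * (x - 2))"
    using x4 by (simp_all add: h_def divide_simps)
  have delta: "(\<Sum>k\<in>A. if k = j then f k else 0) = (if j \<in> A then f j else 0)" if "A \<subseteq> W" for A j and f :: "'a \<Rightarrow> real"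
    using finite_subset[OF that finW] by simp
  have rowT: "(\<Sum>k\<in>W. T i k * f k) = (if i \<in> S then f i / (x + 1) + h * (\<Sum>k\<in>S. f k) else f i / x)"
    if "i \<in> W" for i and f :: "'a \<Rightarrow> real"
  proof -
    have "(\<Sum>k\<in>W. T i k * f k) = (\<Sum>k\<in>W. if k = i then (if i \<in> S then f k / (x + 1) else f k / x) else 0)
        + (\<Sum>k\<in>W. if i \<in> S \<and> k \<in> S then h * f k else 0)"
      unfolding sum.distrib[symmetric] by (intro sum.cong refl) (auto simp: T_def algebra_simps)
    also have "(\<Sum>k\<in>W. if i \<in> S \<and> k \<in> S then h * f k else 0) = (if i \<in> S then h * (\<Sum>k\<in>S. f k) else 0)"
      unfolding split by (auto simp: sum_distrib_left)
    finally show ?thesis using that finW by (simp add: delta)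
  qed
  have Tsym: "T i j = T j i" for i j by (auto simp: T_def)
  have adjW: "(k, j) \<in> parcs G \<longleftrightarrow> k \<in> S \<and> j \<in> S \<and> k \<noteq> j" if "k \<in> W" "j \<in> W" for k j
    using that by (auto simp: arcs W_def)
  have T: "left_inverse_on W T (\<lambda>i j. (if i = j then x else 0) - adj G i j)"
    unfolding left_inverse_on_def
  proof (intro ballI)
    fix i j assume i: "i \<in> W" and j: "j \<in> W"
    have sumS: "(\<Sum>k\<in>S. (if k = j then x else 0) - adj G k j) = (if j \<in> S then x - 2 else 0)"
    proof -
      have "(\<Sum>k\<in>S. (if k = j then x else 0) - adj G k j) =
          (\<Sum>k\<in>S. (if k = j then x + 1 else 0) - (if j \<in> S then 1 else 0))"
        using SW j by (intro sum.cong) (auto simp: adjW subset_iff)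
      then show ?thesis using finS S(2) by (simp add: sum_subtractf)
    qed
    show "(\<Sum>k\<in>W. T i k * ((if k = j then x else 0) - adj G k j)) = (if i = j then 1 else 0)"
      unfolding rowT[OF i] sumS using x4 h(1)
      by (auto simp: adjW[OF i j] adjW[OF j j] field_simps)
  qed
  have p: "(\<Sum>k\<in>W. T i k) = p i" if "i \<in> W" for i
    using rowT[OF that, of "\<lambda>_. 1"] h(2) S(2) by (simp add: p_def)
  have q: "(\<Sum>k\<in>W. T k j) = p j" if "j \<in> W" for j
    using p[OF that] by (simp add: Tsym[of _ j])
  have sp: "(\<Sum>k\<in>W. p k) = 3 / (x - 2) + (x - 4) / x"
    unfolding split by (simp add: p_def S(2) cI)
  have sp2: "(\<Sum>k\<in>W. (p k)\<^sup>2) = 3 / (x - 2)\<^sup>2 + (x - 4) / x\<^sup>2"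
    unfolding split by (simp add: p_def S(2) cI power_divide)
  have sT: "(\<Sum>k\<in>W. T k k) = 3 * ((x - 1) / ((x + 1) * (x - 2))) + (x - 4) / x"
    unfolding split h(3)[symmetric] by (simp add: T_def S(2) cI)
  have "3 / (x - 2) \<le> 3 / 2" "(x - 4) / x \<le> 1" using x4 by (auto simp: field_simps)
  then have "x - (\<Sum>k\<in>W. p k) \<noteq> 0" unfolding sp using x4 by linarith
  from resolvent_energy_dominating[OF G u _ W_def x T p q this]
  show ?thesis unfolding sp sp2 sT using u by (auto simp: arcs)
qed

text \<open>Without \<open>u\<close> the graph is a star with centre \<open>c\<close> and three
  leaves together with \<open>x - 5\<close> isolated vertices. The factor
  \<open>x\<^sup>2 - 3\<close> comes from the nonzero eigenvalues of that star, the two square roots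
  of 3.\<close>

lemma resolvent_energy_dominating_star:
  assumes G: "pair_graph G" and u: "u \<in> pverts G" and c: "c \<in> pverts G - {u}"
    and L: "L \<subseteq> pverts G - {u, c}" "card L = 3"
    and arcs: "\<And>i j. (i, j) \<in> parcs G \<longleftrightarrow> i \<in> pverts G \<and> j \<in> pverts G \<and> i \<noteq> j \<and>
                 (i = u \<or> j = u \<or> i = c \<and> j \<in> L \<or> i \<in> L \<and> j = c)"
    and x: "x = real (card (pverts G))" and gx: "g = 1 / (x\<^sup>2 - 3)"
  shows "5 \<le> x"
    and "resolvent_energy G = (x * g + 3 * ((1 + g) / x) + (x - 5) / x) +
         (1 + ((x + 3)\<^sup>2 * g\<^sup>2 + 3 * ((x + 1)\<^sup>2 * g\<^sup>2) + (x - 5) / x\<^sup>2)) /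
           (x - ((x + 3) * g + 3 * ((x + 1) * g) + (x - 5) / x))"
proof -
  note gr = pair_graphD[OF G]
  define W where "W = pverts G - {u}"
  define I where "I = W - insert c L"
  have finL: "finite L" using L(2) card.infinite by fastforce
  have finW: "finite W" using gr(1) by (simp add: W_def)
  have LW: "insert c L \<subseteq> W" and cL: "c \<notin> L" using L c by (auto simp: W_def)
  have c4: "card (insert c L) = 4" using cL finL L(2) by simp
  have "card (insert c L) \<le> card W" using finW LW by (rule card_mono)
  moreover have cW: "card W = card (pverts G) - 1" using u gr(1) by (simp add: W_def)
  ultimately show x5: "5 \<le> x" using c4 by (simp add: x)
  have cI: "real (card I) = x - 5"
    using cW c4 x5 finL card_Diff_subset[OF _ LW] by (simp add: x I_def)
  have split: "(\<Sum>k\<in>W. f k) = f c + (\<Sum>k\<in>L. f k) + (\<Sum>k\<in>I. f k)" for f :: "'a \<Rightarrow> real"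
    using sum.subset_diff[OF LW finW, of f] finL cL by (simp add: I_def)
  have neI: "k \<noteq> c" "k \<notin> L" "k \<in> W" if "k \<in> I" for k using that by (auto simp: I_def)
  have neL: "k \<noteq> c" "k \<in> W" if "k \<in> L" for k using that cL LW by auto
  have cWm: "c \<in> W" using LW by simp
  have finI: "finite I" using finW by (simp add: I_def)
  define T where "T = (\<lambda>i j. if i = c then (if j = c then x * g else if j \<in> L then g else 0)
     else if i \<in> L then (if j = c then g else if j \<in> L then (if j = i then 1 / x else 0) + g / x else 0)
     else if j = i then 1 / x else 0)"
  define p where "p i = (if i = c then (x + 3) * g else if i \<in> L then (x + 1) * g else 1 / x)" for i
  have "25 \<le> x\<^sup>2" using power_mono[OF x5, of 2] by simp
  \<comment> \<open>The defining relation of \<open>g\<close>, in the form that verifies the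
    inverse, and the bound used below to show that the Schur complement is nonzero.\<close>
  then have g: "g * x\<^sup>2 = 1 + 3 * g" "0 < g" "g \<le> 1 / 22"
    by (simp_all add: gx field_simps)
  then have gxx: "x * (x * g) = 1 + 3 * g" "(1 + 3 * g) / x = x * g"
    using x5 by (simp_all add: power2_eq_square field_simps)
  have Tsym: "T i j = T j i" for i j by (auto simp: T_def)
  have row_c: "(\<Sum>k\<in>W. T c k * f k) = x * g * f c + g * (\<Sum>k\<in>L. f k)" for f :: "'a \<Rightarrow> real"
    unfolding split by (simp add: T_def neL neI sum_distrib_left)
  have row_L: "(\<Sum>k\<in>W. T i k * f k) = g * f c + f i / x + g / x * (\<Sum>k\<in>L. f k)" if "i \<in> L" for i and f :: "'a \<Rightarrow> real"
  proof -
    have "(\<Sum>k\<in>L. T i k * f k) = (\<Sum>k\<in>L. (if k = i then f k / x else 0) + g / x * f k)"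
      using that neL by (intro sum.cong refl) (auto simp: T_def algebra_simps)
    also have "\<dots> = f i / x + g / x * (\<Sum>k\<in>L. f k)"
      using that finL by (simp add: sum.distrib sum_distrib_left)
    moreover have "(\<Sum>k\<in>I. T i k * f k) = 0"
      using that neI neL[OF that] by (intro sum.neutral) (auto simp: T_def)
    ultimately show ?thesis unfolding split using that neL[OF that] by (simp add: T_def)
  qed
  have row_I: "(\<Sum>k\<in>W. T i k * f k) = f i / x" if "i \<in> I" for i and f :: "'a \<Rightarrow> real"
  proof -
    have "(\<Sum>k\<in>W. T i k * f k) = (\<Sum>k\<in>W. if k = i then f k / x else 0)"
      using neI[OF that] by (intro sum.cong refl) (auto simp: T_def)
    then show ?thesis using finW neI[OF that] by simp
  qed
  have cases: "i = c \<or> i \<in> L \<or> i \<in> I" if "i \<in> W" for i using that by (auto simp: I_def)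
  have adjW: "(k, j) \<in> parcs G \<longleftrightarrow> k = c \<and> j \<in> L \<or> k \<in> L \<and> j = c" if "k \<in> W" "j \<in> W" for k j
    using that cL by (auto simp: arcs W_def)
  have T: "left_inverse_on W T (\<lambda>i j. (if i = j then x else 0) - adj G i j)"
    unfolding left_inverse_on_def
  proof (intro ballI)
    fix i j assume i: "i \<in> W" and j: "j \<in> W"
    let ?f = "\<lambda>k. (if k = j then x else 0) - adj G k j"
    have fc: "?f c = (if j = c then x else if j \<in> L then -1 else 0)"
      using cL adjW[OF cWm j] by auto
    have fL: "?f k = (if k = j then x else if j = c then -1 else 0)" if "k \<in> L" for k
      using cL adjW[OF neL(2)[OF that] j] that neL by auto
    have fI: "?f k = (if k = j then x else 0)" if "k \<in> I" for k
      using adjW[OF neI(3)[OF that] j] neI[OF that] by auto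
    have sumL: "(\<Sum>k\<in>L. ?f k) = (if j = c then -3 else if j \<in> L then x else 0)"
    proof -
      have "(\<Sum>k\<in>L. ?f k) = (\<Sum>k\<in>L. if k = j then x else if j = c then -1 else 0)"
        by (intro sum.cong refl fL)
      also have "\<dots> = (\<Sum>k\<in>L. (if k = j then x else 0) + (if j = c then -1 else 0))"
        using neL by (intro sum.cong refl) auto
      finally show ?thesis using finL L(2) cL by (simp add: sum.distrib)
    qed
    show "(\<Sum>k\<in>W. T i k * ?f k) = (if i = j then 1 else 0)"
    proof -
      consider "i = c" | "i \<in> L" | "i \<in> I" using cases[OF i] by blast
      then show ?thesis
      proof cases
        case 1
        show ?thesis unfolding 1 row_c fc sumL using gxx(1) cL by (auto simp: algebra_simps)
      next
        case 2
        show ?thesis unfolding row_L[OF 2] fc sumL fL[OF 2] using 2 neL[OF 2] x5 gxx(1)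
          by (auto simp: field_simps)
      next
        case 3
        show ?thesis unfolding row_I[OF 3] fI[OF 3] using x5 by auto
      qed
    qed
  qed
  have p: "(\<Sum>k\<in>W. T i k) = p i" if i: "i \<in> W" for i
  proof -
    consider "i = c" | "i \<in> L" | "i \<in> I" using cases[OF i] by blast
    then show ?thesis
    proof cases
      case 1 then show ?thesis using row_c[of "\<lambda>_. 1"] L(2) by (simp add: p_def algebra_simps)
    next
      case 2 then show ?thesis
        using row_L[OF 2, of "\<lambda>_. 1"] L(2) neL[OF 2] gxx(2) by (simp add: p_def algebra_simps add_divide_distrib)
    next
      case 3 then show ?thesis using row_I[OF 3, of "\<lambda>_. 1"] neI[OF 3] by (simp add: p_def)
    qed
  qed
  have q: "(\<Sum>k\<in>W. T k j) = p j" if "j \<in> W" for j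
    using p[OF that] by (simp add: Tsym[of _ j])
  have sp: "(\<Sum>k\<in>W. p k) = (x + 3) * g + 3 * ((x + 1) * g) + (x - 5) / x"
    unfolding split by (simp add: p_def neL neI L(2) cI)
  have sp2: "(\<Sum>k\<in>W. (p k)\<^sup>2) = (x + 3)\<^sup>2 * g\<^sup>2 + 3 * ((x + 1)\<^sup>2 * g\<^sup>2) + (x - 5) / x\<^sup>2"
    unfolding split by (simp add: p_def neL neI L(2) cI power_mult_distrib power_divide)
  have sT: "(\<Sum>k\<in>W. T k k) = x * g + 3 * ((1 + g) / x) + (x - 5) / x"
    unfolding split by (simp add: T_def neL neI L(2) cI add_divide_distrib)
  have "(\<Sum>k\<in>W. p k) < x"
  proof -
    have "g * (4 * x + 6) \<le> 1 / 22 * (4 * x + 6)"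
      using g(3) x5 by (intro mult_right_mono) auto
    also have "\<dots> < x - 1" using x5 by simp
    finally have "g * (4 * x + 6) < x - 1" .
    moreover have "(x - 5) / x \<le> 1" using x5 by simp
    ultimately have "g * (4 * x + 6) + (x - 5) / x < (x - 1) + 1" by (rule add_less_le_mono)
    then show ?thesis unfolding sp by (simp add: algebra_simps)
  qed
  then have "x - (\<Sum>k\<in>W. p k) \<noteq> 0" by simp
  from resolvent_energy_dominating[OF G u _ W_def x T p q this]
  show "resolvent_energy G = (x * g + 3 * ((1 + g) / x) + (x - 5) / x) +
         (1 + ((x + 3)\<^sup>2 * g\<^sup>2 + 3 * ((x + 1)\<^sup>2 * g\<^sup>2) + (x - 5) / x\<^sup>2)) /
           (x - ((x + 3) * g + 3 * ((x + 1) * g) + (x - 5) / x))"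
    unfolding sp sp2 sT using u by (auto simp: arcs)
qed

section \<open>Isomorphism invariance and recognition of \<open>Z1_graph\<close>\<close>

text \<open>A digraph isomorphism carries separate maps for vertices, arcs, tails and heads. Here
  tails and heads are the pair projections, so the vertex map determines the arc map.\<close>

lemma digraph_iso_with_proj_iff:
  assumes G: "pair_graph G" and H: "pair_graph H"
  shows "digraph_iso (with_proj G) (with_proj H) \<longleftrightarrow>
    (\<exists>f. bij_betw f (pverts G) (pverts H) \<and>
         (\<forall>i\<in>pverts G. \<forall>j\<in>pverts G. (i, j) \<in> parcs G \<longleftrightarrow> (f i, f j) \<in> parcs H))"
    (is "?L \<longleftrightarrow> ?R")
proof
  assume ?L
  then obtain hom where iso: "pre_digraph.digraph_isomorphism (with_proj G) hom"
    and eq: "with_proj H = app_iso hom (with_proj G)"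
    by (auto simp: digraph_iso_def)
  let ?f = "iso_verts hom"
  have inj: "inj_on ?f (pverts G)"
    and ends: "\<And>a. a \<in> parcs G \<Longrightarrow> ?f (fst a) = iso_tail hom (iso_arcs hom a)"
      "\<And>a. a \<in> parcs G \<Longrightarrow> ?f (snd a) = iso_head hom (iso_arcs hom a)"
    using iso by (auto simp: pre_digraph.digraph_isomorphism_def)
  have verts: "pverts H = ?f ` pverts G" and arcs: "parcs H = iso_arcs hom ` parcs G"
    and tail: "iso_tail hom = fst" and head: "iso_head hom = snd"
    using arg_cong[OF eq, of verts] arg_cong[OF eq, of arcs]
      arg_cong[OF eq, of tail] arg_cong[OF eq, of head] by auto
  have "iso_arcs hom (i, j) = (?f i, ?f j)" if "(i, j) \<in> parcs G" for i j
    using ends[OF that] by (simp add: tail head prod_eq_iff)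
  then have arcs': "parcs H = (\<lambda>(i, j). (?f i, ?f j)) ` parcs G" unfolding arcs by force
  have "(i, j) \<in> parcs G \<longleftrightarrow> (?f i, ?f j) \<in> parcs H" if "i \<in> pverts G" "j \<in> pverts G" for i j
  proof
    assume "(?f i, ?f j) \<in> parcs H"
    then obtain k l where kl: "(k, l) \<in> parcs G" "?f i = ?f k" "?f j = ?f l" by (auto simp: arcs')
    then have "k \<in> pverts G" "l \<in> pverts G" using pair_graphD(2)[OF G] by auto
    then show "(i, j) \<in> parcs G" using kl inj_onD[OF inj] that by metis
  qed (auto simp: arcs')
  then show ?R using inj verts by (intro exI[of _ ?f]) (auto simp: bij_betw_def)
next
  assume ?R
  then obtain f where f: "bij_betw f (pverts G) (pverts H)"
    and arcs: "\<And>i j. i \<in> pverts G \<Longrightarrow> j \<in> pverts G \<Longrightarrow> (i, j) \<in> parcs G \<longleftrightarrow> (f i, f j) \<in> parcs H"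
    by blast
  note g = pair_graphD[OF G] and h = pair_graphD[OF H]
  let ?hom = "\<lparr> iso_verts = f, iso_arcs = map_prod f f, iso_head = snd, iso_tail = fst \<rparr>"
  have inj: "inj_on f (pverts G)" and im: "f ` pverts G = pverts H" using f by (auto simp: bij_betw_def)
  have "inj_on (map_prod f f) (parcs G)"
    using map_prod_inj_on[OF inj inj] g(2) by (rule inj_on_subset)
  moreover have "wf_digraph (with_proj G)"
    using G by (simp add: wf_digraph_wp_iff pair_graph_def pair_digraph_def pair_fin_digraph_def)
  ultimately have "pre_digraph.digraph_isomorphism (with_proj G) ?hom"
    using inj by (auto simp: pre_digraph.digraph_isomorphism_def)
  moreover have "map_prod f f ` parcs G = parcs H"
  proof (intro equalityI subsetI)
    fix e assume e: "e \<in> parcs H"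
    then obtain a b where ab: "e = (a, b)" "a \<in> pverts H" "b \<in> pverts H" using h(2) by auto
    obtain i j where "i \<in> pverts G" "a = f i" "j \<in> pverts G" "b = f j"
      using ab(2,3) unfolding im[symmetric] by blast
    with ab have "i \<in> pverts G" "j \<in> pverts G" "e = (f i, f j)" by auto
    then show "e \<in> map_prod f f ` parcs G" using e arcs by force
  qed (use arcs g(2) in auto)
  then have "with_proj H = app_iso ?hom (with_proj G)"
    by (simp add: app_iso_def with_proj_def im)
  ultimately show ?L unfolding digraph_iso_def by blast
qed

text \<open>Relabelling a resolvent of \<open>H\<close> along the vertex bijection gives one of
  \<open>G\<close> with the same trace. The vertex types may differ.\<close>

lemma resolvent_energy_iso:
  assumes G: "pair_graph G" and H: "pair_graph H" and iso: "digraph_iso (with_proj G) (with_proj H)"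
  shows "resolvent_energy G = resolvent_energy H"
proof -
  note g = pair_graphD[OF G] and h = pair_graphD[OF H]
  obtain f where f: "bij_betw f (pverts G) (pverts H)"
    and arcs: "\<And>i j. i \<in> pverts G \<Longrightarrow> j \<in> pverts G \<Longrightarrow> (i, j) \<in> parcs G \<longleftrightarrow> (f i, f j) \<in> parcs H"
    using iso unfolding digraph_iso_with_proj_iff[OF G H] by blast
  have inj: "inj_on f (pverts G)" and im: "f ` pverts G = pverts H" using f by (auto simp: bij_betw_def)
  have card: "card (pverts G) = card (pverts H)" using f by (rule bij_betw_same_card)
  have "(\<Sum>j\<in>pverts H. adj H i j) < real (card (pverts H))" if "i \<in> pverts H" for i
    using sum_adj_le[OF H that] by linarith
  then obtain R where R: "left_inverse_on (pverts H) R
      (\<lambda>i j. (if i = j then real (card (pverts H)) else 0) - adj H i j)"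
    using M_matrix_left_inverse[OF h(1), of "adj H" "real (card (pverts H))"] by auto
  have "left_inverse_on (pverts G) (\<lambda>i j. R (f i) (f j))
      (\<lambda>i j. (if i = j then real (card (pverts G)) else 0) - adj G i j)"
    unfolding left_inverse_on_def
  proof (intro ballI)
    fix i j assume i: "i \<in> pverts G" and j: "j \<in> pverts G"
    have "(\<Sum>k\<in>pverts G. R (f i) (f k) * ((if k = j then real (card (pverts G)) else 0) - adj G k j))
      = (\<Sum>k\<in>pverts G. R (f i) (f k) * ((if f k = f j then real (card (pverts H)) else 0) - adj H (f k) (f j)))"
      using j inj_on_eq_iff[OF inj] arcs by (intro sum.cong refl) (simp add: card)
    also have "\<dots> = (\<Sum>k\<in>pverts H. R (f i) k * ((if k = f j then real (card (pverts H)) else 0) - adj H k (f j)))"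
      by (rule sum.reindex_bij_betw[OF f])
    also have "\<dots> = (if f i = f j then 1 else 0)"
      using i j im by (intro left_inverse_onD[OF R]) auto
    finally show "(\<Sum>k\<in>pverts G. R (f i) (f k) * ((if k = j then real (card (pverts G)) else 0) - adj G k j))
       = (if i = j then 1 else 0)"
      using inj_on_eq_iff[OF inj] i j by simp
  qed
  from resolvent_energy_eq_diag_sum[OF g(1,3) this]
  have "resolvent_energy G = (\<Sum>i\<in>pverts G. R (f i) (f i))" .
  also have "\<dots> = (\<Sum>i\<in>pverts H. R i i)" by (rule sum.reindex_bij_betw[OF f])
  also have "\<dots> = resolvent_energy H" by (rule resolvent_energy_eq_diag_sum[OF h(1,3) R, symmetric])
  finally show ?thesis .
qed

text \<open>Puts \<open>Z1_graph\<close> into the shape of the triangle case, with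
  \<open>u = 0\<close> and \<open>S = {1, 2, 3}\<close>, so that the explicit energy formula applies
  to it.\<close>

lemma Z1_graph_arcs_iff:
  assumes "4 \<le> n"
  shows "(i, j) \<in> parcs (Z1_graph n) \<longleftrightarrow> i \<in> pverts (Z1_graph n) \<and> j \<in> pverts (Z1_graph n) \<and> i \<noteq> j \<and>
     (i = 0 \<or> j = 0 \<or> i \<in> {1, 2, 3} \<and> j \<in> {1, 2, 3})"
  using assms by (auto simp: Z1_graph_def)

lemma pair_graph_Z1_graph: "4 \<le> n \<Longrightarrow> pair_graph (Z1_graph n)"
  by (rule pair_graphI) (auto simp: Z1_graph_def sym_def irrefl_def)

lemma dominating_triangle_iso_Z1_graph:
  assumes G: "pair_graph G" and u: "u \<in> pverts G" and S: "S \<subseteq> pverts G - {u}" "card S = 3"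
    and arcs: "\<And>i j. (i, j) \<in> parcs G \<longleftrightarrow> i \<in> pverts G \<and> j \<in> pverts G \<and> i \<noteq> j \<and>
                 (i = u \<or> j = u \<or> i \<in> S \<and> j \<in> S)"
    and n: "card (pverts G) = n" "4 \<le> n"
  shows "digraph_iso (with_proj G) (with_proj (Z1_graph n))"
proof -
  note g = pair_graphD[OF G]
  have finS: "finite S" using S(2) card.infinite by fastforce
  obtain f1 where f1: "bij_betw f1 S {1, 2, 3::nat}"
    using finite_same_card_bij[OF finS, of "{1, 2, 3::nat}"] S(2) by auto
  have "card (pverts G - insert u S) = card {4..<n}"
    using S u g(1) finS n by (subst card_Diff_subset) (auto simp: card_insert_if)
  then obtain f2 where f2: "bij_betw f2 (pverts G - insert u S) {4..<n}"
    using g(1) by (metis finite_Diff finite_atLeastLessThan finite_same_card_bij)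
  define f where "f i = (if i = u then 0 else if i \<in> S then f1 i else f2 i)" for i
  have "bij_betw f {u} {0}" by (simp add: f_def bij_betw_def)
  moreover have "bij_betw f S {1, 2, 3}"
    using f1 S by (subst bij_betw_cong[of S f f1]) (auto simp: f_def)
  moreover have "bij_betw f (pverts G - insert u S) {4..<n}"
    using f2 by (subst bij_betw_cong[of _ f f2]) (auto simp: f_def)
  ultimately have "bij_betw f ({u} \<union> S \<union> (pverts G - insert u S)) ({0} \<union> {1, 2, 3} \<union> {4..<n})"
    by (intro bij_betw_combine) auto
  moreover have "{u} \<union> S \<union> (pverts G - insert u S) = pverts G" using u S by auto
  moreover have "{0} \<union> {1, 2, 3} \<union> {4..<n} = pverts (Z1_graph n)" using n by (auto simp: Z1_graph_def)
  ultimately have bij: "bij_betw f (pverts G) (pverts (Z1_graph n))" by simp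
  have f0: "f i = 0 \<longleftrightarrow> i = u" and fS: "f i \<in> {1, 2, 3} \<longleftrightarrow> i \<in> S" if "i \<in> pverts G" for i
  proof -
    have "f1 i \<in> {1, 2, 3}" if "i \<in> S" using f1 that by (auto simp: bij_betw_def)
    moreover have "f2 i \<in> {4..<n}" if "i \<notin> insert u S"
      using f2 that \<open>i \<in> pverts G\<close> by (auto simp: bij_betw_def)
    ultimately show "f i = 0 \<longleftrightarrow> i = u" "f i \<in> {1, 2, 3} \<longleftrightarrow> i \<in> S"
      using S by (auto simp: f_def)
  qed
  have "(i, j) \<in> parcs G \<longleftrightarrow> (f i, f j) \<in> parcs (Z1_graph n)" if "i \<in> pverts G" "j \<in> pverts G" for i j
  proof -
    have "f i \<in> pverts (Z1_graph n)" "f j \<in> pverts (Z1_graph n)" "f i = f j \<longleftrightarrow> i = j"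
      using bij that by (auto simp: bij_betw_def inj_on_def)
    then show ?thesis unfolding arcs[of i j] Z1_graph_arcs_iff[OF n(2)] f0[OF that(1)] f0[OF that(2)]
        fS[OF that(1)] fS[OF that(2)] using that by blast
  qed
  then show ?thesis
    unfolding digraph_iso_with_proj_iff[OF G pair_graph_Z1_graph[OF n(2)]] using bij by blast
qed

section \<open>Comparison of maximizers with \<open>Z1_graph\<close>\<close>

lemma max_resolvent_energy_cases:
  assumes G: "tricyclic G"
    and max: "\<And>H. tricyclic H \<Longrightarrow> pverts H = pverts G \<Longrightarrow> resolvent_energy H \<le> resolvent_energy G"
    and n: "card (pverts G) = n" "4 \<le> n"
  shows "digraph_iso (with_proj G) (with_proj (Z1_graph n)) \<or>
         resolvent_energy G < resolvent_energy (Z1_graph n)"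
proof -
  note G' = tricyclicD(1)[OF G]
  have ne: "pverts G \<noteq> {}" using n by auto
  show ?thesis
  proof (rule max_resolvent_energy_structure[OF G max ne])
    fix u S assume "u \<in> pverts G" "S \<subseteq> pverts G - {u}" "card S = 3"
      "\<And>i j. (i, j) \<in> parcs G \<longleftrightarrow> i \<in> pverts G \<and> j \<in> pverts G \<and> i \<noteq> j \<and>
                 (i = u \<or> j = u \<or> i \<in> S \<and> j \<in> S)"
    then show ?thesis using dominating_triangle_iso_Z1_graph[OF G' _ _ _ _ n] by blast
  next
    fix u c L assume *: "u \<in> pverts G" "c \<in> pverts G - {u}" "L \<subseteq> pverts G - {u, c}" "card L = 3"
      "\<And>i j. (i, j) \<in> parcs G \<longleftrightarrow> i \<in> pverts G \<and> j \<in> pverts G \<and> i \<noteq> j \<and>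
                 (i = u \<or> j = u \<or> i = c \<and> j \<in> L \<or> i \<in> L \<and> j = c)"
    note star = resolvent_energy_dominating_star[OF G' * n(1)[symmetric, THEN arg_cong[where f = real]] refl]
    have "resolvent_energy (Z1_graph n) =
      (3 * ((real n - 1) / ((real n + 1) * (real n - 2))) + (real n - 4) / real n) +
         (1 + (3 / (real n - 2)\<^sup>2 + (real n - 4) / (real n)\<^sup>2)) / (real n - (3 / (real n - 2) + (real n - 4) / real n))"
      by (rule resolvent_energy_dominating_triangle[OF pair_graph_Z1_graph[OF n(2)] _ _ _ Z1_graph_arcs_iff[OF n(2)]])
        (use n in \<open>auto simp: Z1_graph_def\<close>)
    then show ?thesis using star(2) star_triangle_inequality[OF star(1) refl] by simp
  qed
qed

theorem theorem10:
  fixes G :: "'a pair_pre_digraph" and n :: nat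
  assumes "n \<ge> 4"
    and "tricyclic G"
    and "card (pverts G) = n"
  shows "resolvent_energy G \<le> resolvent_energy (Z1_graph n) \<and>
    (resolvent_energy G = resolvent_energy (Z1_graph n) \<longleftrightarrow>
      digraph_iso (with_proj G) (with_proj (Z1_graph n)))"
proof -
  note Z = pair_graph_Z1_graph[OF assms(1)]
  define C where "C = {H. tricyclic H \<and> pverts H = pverts G}"
  have fin: "finite (pverts G)" using pair_graphD(1)[OF tricyclicD(1)[OF assms(2)]] .
  \<comment> \<open>All competitors have the vertex set of \<open>G\<close>, so they are determined
    by their arcs; there are finitely many and a maximizer exists.\<close>
  have "C \<subseteq> (\<lambda>E. \<lparr>pverts = pverts G, parcs = E\<rparr>) ` Pow (pverts G \<times> pverts G)"
  proof
    fix H assume H: "H \<in> C"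
    then have "parcs H \<in> Pow (pverts G \<times> pverts G)"
      using pair_graphD(2)[OF tricyclicD(1), of H] by (auto simp: C_def)
    moreover have "H = \<lparr>pverts = pverts G, parcs = parcs H\<rparr>" using H by (simp add: C_def)
    ultimately show "H \<in> (\<lambda>E. \<lparr>pverts = pverts G, parcs = E\<rparr>) ` Pow (pverts G \<times> pverts G)" by blast
  qed
  then have finC: "finite C" by (rule finite_subset) (use fin in simp)
  have GC: "G \<in> C" using assms by (simp add: C_def)
  have top: "digraph_iso (with_proj H) (with_proj (Z1_graph n)) \<or>
      resolvent_energy H < resolvent_energy (Z1_graph n)"
    if "H \<in> C" "\<And>K. K \<in> C \<Longrightarrow> resolvent_energy K \<le> resolvent_energy H" for H
    using that assms by (intro max_resolvent_energy_cases) (auto simp: C_def)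
  have "Max (resolvent_energy ` C) \<in> resolvent_energy ` C" using finC GC by (intro Max_in) auto
  then obtain H where H: "H \<in> C" "resolvent_energy H = Max (resolvent_energy ` C)" by auto
  have Hmax: "resolvent_energy K \<le> resolvent_energy H" if "K \<in> C" for K
    using that finC H(2) by auto
  have HZ: "resolvent_energy H \<le> resolvent_energy (Z1_graph n)"
    using top[OF H(1) Hmax] resolvent_energy_iso[OF _ Z, of H] tricyclicD(1)[of H] H(1)
    by (auto simp: C_def)
  have le: "resolvent_energy G \<le> resolvent_energy (Z1_graph n)" using Hmax[OF GC] HZ by simp
  \<comment> \<open>Equality makes \<open>G\<close> itself a maximizer in \<open>C\<close>, and
    rules out the strict alternative of \<open>top\<close>.\<close>
  moreover have "digraph_iso (with_proj G) (with_proj (Z1_graph n))"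
    if "resolvent_energy G = resolvent_energy (Z1_graph n)"
    using top[OF GC] Hmax HZ that by fastforce
  moreover have "resolvent_energy G = resolvent_energy (Z1_graph n)"
    if "digraph_iso (with_proj G) (with_proj (Z1_graph n))"
    by (rule resolvent_energy_iso[OF tricyclicD(1)[OF assms(2)] Z that])
  ultimately show ?thesis by blast
qed

end
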